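(* Let $n \ge 1$ and $m \ge 0$ be integers, and let $Q, r, X_1,\ldots,X_n$ be indeterminates. For a function $f$ of $X_1,\ldots,X_n$ put $\mathbf{ASym}_{X_1,\ldots,X_n} f(X_1,\ldots,X_n) = \sum_{\sigma \in \mathcal{S}_n} \operatorname{sgn}\sigma \cdot f(X_{\sigma(1)},\ldots,X_{\sigma(n)})$. Then, as an identity of rational functions, \begin{multline*} \frac{1}{\prod_{1 \le i < j \le n} (X_j-X_i)} \mathbf{ASym}_{X_1,\ldots,X_n} \Bigg[ \prod_{1 \le i < j \le n} (Q+(Q+r) X_i+X_j + X_i X_j) \\ \times \sum_{0 \le k_1 < k_2 < \cdots < k_n \le m} \prod_{i=1}^n \left( \frac{X_i(1+X_i)}{Q+X_i} \right)^{k_i} \Bigg] = \frac{\det_{1 \le i, j \le n} \left( a_{j,m,n}(Q,r;X_i) \right)}{\prod_{1 \le i \le j \le n} (Q-X_i X_j) \prod_{1 \le i < j \le n} (X_j-X_i)}, \end{multline*} where \begin{multline*} a_{j,m,n}(Q,r;X) = (1+Q X^{-1}) X^{j} (1+X)^{j-1} (Q+ r X + Q X)^{n-j} \\ - X^{2 n} Q^{-n} \left( \frac{(1+X) X}{Q+X} \right)^{m} (1+X) \left( Q X^{-1} \right)^{j} (1+Q X^{-1})^{j-1} (Q+r Q X^{-1} + Q^2 X^{-1})^{n-j}. \end{multline*}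
   Context: $\mathcal{S}_n$ is the symmetric group on $\{1,\ldots,n\}$. The products $\prod_{1\le i\le j\le n}$ include the diagonal terms $i=j$. *)

theory Defs
  imports
    "HOL-Library.Poly_Mapping"
    "HOL-Library.FuncSet"
    "HOL-Computational_Algebra.Fraction_Field"
    "HOL-Combinatorics.Permutations"
    "Jordan_Normal_Form.Determinant"
begin

text \<open>
  Rational functions over a field \<^typ>\<open>'k\<close> in countably many indeterminates: fractions of
  polynomials, where a polynomial is a finitely supported function from monomials
  (finitely supported exponent vectors) to coefficients.
\<close>

type_synonym 'k ratfun = "((nat \<Rightarrow>\<^sub>0 nat) \<Rightarrow>\<^sub>0 'k) fract"

definition indet :: "nat \<Rightarrow> 'k::field ratfun" where
  "indet v = Fract (Poly_Mapping.single (Poly_Mapping.single v 1) 1) 1"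

text \<open>The indeterminates $Q$, $r$, $X_1, X_2, \ldots$ are the variables numbered 0, 1, 2, 3, \ldots\<close>

definition indet_Q :: "'k::field ratfun" where "indet_Q = indet 0"
definition indet_r :: "'k::field ratfun" where "indet_r = indet 1"
definition indet_X :: "nat \<Rightarrow> 'k::field ratfun" where "indet_X i = indet (i + 1)"

definition ASym :: "nat \<Rightarrow> ((nat \<Rightarrow> 'a) \<Rightarrow> 'a) \<Rightarrow> (nat \<Rightarrow> 'a) \<Rightarrow> 'a::comm_ring_1" where
  "ASym n f X = (\<Sum>\<sigma> | \<sigma> permutes {1..n}. of_int (sign \<sigma>) * f (\<lambda>i. X (\<sigma> i)))"

definition incr_seqs :: "nat \<Rightarrow> nat \<Rightarrow> (nat \<Rightarrow> nat) set" where
  "incr_seqs n m = {k \<in> {1..n} \<rightarrow>\<^sub>E {0..m}. strict_mono_on {1..n} k}"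

definition a_entry :: "nat \<Rightarrow> nat \<Rightarrow> nat \<Rightarrow> 'a \<Rightarrow> 'a \<Rightarrow> 'a \<Rightarrow> 'a::field" where
  "a_entry j m n Q r X =
     (1 + Q * inverse X) * X ^ j * (1 + X) ^ (j - 1) * (Q + r * X + Q * X) ^ (n - j)
     - X ^ (2 * n) * inverse (Q ^ n) * ((1 + X) * X / (Q + X)) ^ m * (1 + X)
       * (Q * inverse X) ^ j * (1 + Q * inverse X) ^ (j - 1)
       * (Q + r * Q * inverse X + Q\<^sup>2 * inverse X) ^ (n - j)"

end

theory Submission
  imports
    Defs
    "HOL-Combinatorics.Multiset_Permutations"
    "HOL-Computational_Algebra.Polynomial"
begin

text \<open>
  Put $c = Q + r$ and $y_i = X_i (1 + X_i) / (Q + X_i)$; the substitution $X \mapsto Q/X$ inverts $y$.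
  Dividing by the Vandermonde product turns the left-hand side into a symmetric sum over all orderings of
  the index set. Splitting off the variable with the largest exponent $k_n$ gives a recursion in $m$
  and in the index set.

  Each row of the determinant is a difference of two rows that are exchanged by $X_i \mapsto Q/X_i$.
  Expanding along these differences and evaluating homogeneous Vandermonde determinants writes the
  right-hand side as $\sum_S \mathrm{coeff}(S) \prod_{i \in S} y_i^{m+1}$ over subsets $S$ of the indices.
  Comparing coefficients of $\prod_{i \in S} y_i^{m+1}$ reduces the recursion to a partial fraction
  identity for $1 - \prod_{i \in S} y_i$. The initial value at $m = -1$ vanishes because the determinant
  then has rank less than $n$.
\<close>

section \<open>Products over pairs of indices\<close>

definition pairs :: "nat set \<Rightarrow> (nat \<times> nat) set" where
  "pairs S = {(i, j). i \<in> S \<and> j \<in> S \<and> i < j}"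

lemma finite_pairs [simp]: "finite S \<Longrightarrow> finite (pairs S)"
  by (rule finite_subset[of _ "S \<times> S"]) (auto simp: pairs_def)

lemma prod_pairs_remove:
  fixes p :: "nat \<Rightarrow> nat \<Rightarrow> 'a::comm_monoid_mult"
  assumes "finite S" "i \<in> S" and sym: "\<And>a b. p a b = p b a"
  shows "(\<Prod>(a, b)\<in>pairs S. p a b) = (\<Prod>j\<in>S - {i}. p i j) * (\<Prod>(a, b)\<in>pairs (S - {i}). p a b)"
proof -
  \<comment> \<open>Symmetry of \<open>p\<close> allows each pair through \<open>i\<close> to be
    written with the smaller index first.\<close>
  let ?f = "\<lambda>j. (min i j, max i j)"
  have eq: "pairs S = ?f ` (S - {i}) \<union> pairs (S - {i})"
  proof (intro equalityI subsetI)
    fix z assume "z \<in> pairs S"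
    then obtain a b where z: "z = (a, b)" "a \<in> S" "b \<in> S" "a < b" by (auto simp: pairs_def)
    consider "a = i" | "b = i" | "a \<noteq> i" "b \<noteq> i" by blast
    thus "z \<in> ?f ` (S - {i}) \<union> pairs (S - {i})"
    proof cases
      case 1 thus ?thesis using z by (intro UnI1 image_eqI[of _ _ b]) auto
    next
      case 2 thus ?thesis using z by (intro UnI1 image_eqI[of _ _ a]) auto
    next
      case 3 thus ?thesis using z by (auto simp: pairs_def)
    qed
  qed (use assms in \<open>auto simp: pairs_def min_def max_def\<close>)
  have minmax: "p (min i j) (max i j) = p i j" for j
    by (cases "i \<le> j") (simp_all add: min_def max_def sym[of j i])
  have inj: "inj_on ?f (S - {i})"
    by (auto simp: inj_on_def min_def max_def split: if_splits)
  have "(\<Prod>(a, b)\<in>pairs S. p a b)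
      = (\<Prod>(a, b)\<in>?f ` (S - {i}). p a b) * (\<Prod>(a, b)\<in>pairs (S - {i}). p a b)"
    unfolding eq using assms
    by (intro prod.union_disjoint finite_pairs) (auto simp: pairs_def min_def max_def split: if_splits)
  also have "(\<Prod>(a, b)\<in>?f ` (S - {i}). p a b) = (\<Prod>j\<in>S - {i}. p i j)"
    by (simp add: prod.reindex[OF inj] minmax)
  finally show ?thesis .
qed

text \<open>Each index lies in exactly \<open>card S - 1\<close> pairs. This moves monomial row
  factors into and out of Vandermonde-type products.\<close>

lemma prod_pairs_weights:
  fixes w :: "nat \<Rightarrow> 'a::comm_monoid_mult"
  assumes "finite S"
  shows "(\<Prod>(a, b)\<in>pairs S. w a * w b) = (\<Prod>i\<in>S. w i ^ (card S - 1))"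
  using assms
proof (induction S rule: finite_induct)
  case empty
  thus ?case by (simp add: pairs_def)
next
  case (insert x S)
  have "(\<Prod>(a, b)\<in>pairs (insert x S). w a * w b)
      = (\<Prod>j\<in>S. w x * w j) * (\<Prod>i\<in>S. w i ^ (card S - 1))"
    using insert prod_pairs_remove[of "insert x S" x "\<lambda>a b. w a * w b"]
    by (simp add: mult.commute)
  also have "\<dots> = w x ^ card S * (\<Prod>i\<in>S. w i * w i ^ (card S - 1))"
    by (simp add: prod.distrib mult.assoc)
  also have "(\<Prod>i\<in>S. w i * w i ^ (card S - 1)) = (\<Prod>i\<in>S. w i ^ card S)"
    using insert.hyps by (intro prod.cong refl) (metis card_gt_0_iff empty_iff power_minus_mult mult.commute)
  finally show ?case using insert.hyps by simp
qed

section \<open>Partial fractions and the weights y_i\<close>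

text \<open>A product of functions of \<open>x\<close> with simple poles \<open>s j\<close> and
  values \<open>y j\<close> at infinity. The point \<open>x\<close> stays arbitrary in the induction
  because a new pole \<open>s k\<close> needs the hypothesis twice: at \<open>x\<close>, and at
  \<open>s k\<close>, where it gives the coefficient of that pole.\<close>

lemma prod_partial_fractions:
  fixes y e s :: "'b \<Rightarrow> 'a::field"
  assumes "finite S" "inj_on s S" "\<And>j. j \<in> S \<Longrightarrow> s j \<noteq> x"
  shows "(\<Prod>j\<in>S. y j + e j / (s j - x))
       = (\<Prod>j\<in>S. y j)
         + (\<Sum>i\<in>S. e i / (s i - x) * (\<Prod>j\<in>S - {i}. y j + e j / (s j - s i)))"
  using assms
proof (induction S arbitrary: x rule: finite_induct)
  case empty
  thus ?case by simp
next
  case (insert k S)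
  define P where "P i = (\<Prod>j\<in>S - {i}. y j + e j / (s j - s i))" for i
  have nk: "s i \<noteq> s k" if "i \<in> S" for i
    using insert.prems(1) insert.hyps that by (auto simp: inj_on_def)
  have IH: "(\<Prod>j\<in>S. y j + e j / (s j - z)) = (\<Prod>j\<in>S. y j) + (\<Sum>i\<in>S. e i / (s i - z) * P i)"
    if "\<And>j. j \<in> S \<Longrightarrow> s j \<noteq> z" for z
    unfolding P_def using insert.IH[of z] insert.prems that by auto
  \<comment> \<open>The product of the poles at \<open>s k\<close> and \<open>s i\<close> separates
    into one term per pole, the other factor being evaluated at that pole.\<close>
  have pf: "(y k + e k / (s k - x)) * (e i / (s i - x))
      = e i / (s i - x) * (y k + e k / (s k - s i)) + e k / (s k - x) * (e i / (s i - s k))"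
    if "i \<in> S" for i
  proof -
    have "s i - x \<noteq> 0" "s k - x \<noteq> 0" "s i - s k \<noteq> 0" "s k - s i \<noteq> 0"
      using nk[OF that] insert.prems that by auto
    thus ?thesis by (simp add: divide_simps) (simp add: algebra_simps)
  qed
  have P': "(\<Prod>j\<in>insert k S - {i}. y j + e j / (s j - s i)) = (y k + e k / (s k - s i)) * P i"
    if "i \<in> S" for i
  proof -
    have "insert k S - {i} = insert k (S - {i})" using that insert.hyps by auto
    thus ?thesis using insert.hyps by (simp add: P_def)
  qed
  have "(\<Prod>j\<in>insert k S. y j + e j / (s j - x))
      = (y k + e k / (s k - x)) * ((\<Prod>j\<in>S. y j) + (\<Sum>i\<in>S. e i / (s i - x) * P i))"
    using insert by (simp add: IH)
  also have "\<dots> = y k * (\<Prod>j\<in>S. y j) + e k / (s k - x) * (\<Prod>j\<in>S. y j)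
      + (\<Sum>i\<in>S. (y k + e k / (s k - x)) * (e i / (s i - x)) * P i)"
    by (simp add: ring_distribs sum_distrib_left mult.assoc del: times_divide_eq_left times_divide_eq_right)
  also have "(\<Sum>i\<in>S. (y k + e k / (s k - x)) * (e i / (s i - x)) * P i)
      = (\<Sum>i\<in>S. e i / (s i - x) * ((y k + e k / (s k - s i)) * P i))
        + e k / (s k - x) * (\<Sum>i\<in>S. e i / (s i - s k) * P i)"
    unfolding sum_distrib_left sum.distrib[symmetric]
  proof (intro sum.cong refl, goal_cases)
    case (1 i)
    show ?case by (subst pf[OF 1]) (simp add: ring_distribs mult.assoc)
  qed
  also have "(\<Sum>i\<in>S. e i / (s i - x) * ((y k + e k / (s k - s i)) * P i))
      = (\<Sum>i\<in>S. e i / (s i - x) * (\<Prod>j\<in>insert k S - {i}. y j + e j / (s j - s i)))"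
    by (intro sum.cong refl) (simp add: P')
  finally show ?case
    using insert.hyps nk IH[of "s k"] by (simp add: algebra_simps add_divide_distrib)
qed

text \<open>\<open>outer_factor\<close> is the cofactor of z - x in z (1 + z) (Q + c x) - x (1 + x)
  (Q + c z). Up to a monomial, replacing x by Q/x turns it into \<open>mixed_factor\<close> with
  swapped arguments, and replacing both variables gives \<open>inner_factor\<close>.
  \<open>mixed_factor\<close> is also the factor inside the antisymmetrizer.\<close>

definition mixed_factor :: "'a::field \<Rightarrow> 'a \<Rightarrow> 'a \<Rightarrow> 'a \<Rightarrow> 'a" where
  "mixed_factor Q c x z = Q + c * x + z + x * z"

definition inner_factor :: "'a::field \<Rightarrow> 'a \<Rightarrow> 'a \<Rightarrow> 'a \<Rightarrow> 'a" where
  "inner_factor Q c x z = x * z + Q * x + Q * z + c * Q"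

definition outer_factor :: "'a::field \<Rightarrow> 'a \<Rightarrow> 'a \<Rightarrow> 'a \<Rightarrow> 'a" where
  "outer_factor Q c x z = Q + Q * x + Q * z + c * x * z"

definition weight :: "'a::field \<Rightarrow> 'a \<Rightarrow> 'a" where
  "weight Q x = x * (1 + x) / (Q + x)"

text \<open>Nondegeneracy in a form that passes to subsets and relabelled families.
  \<open>mixed_nz\<close> and \<open>inner_nz\<close> keep the partial fraction poles away from -1-c
  and distinct; \<open>cX_nz\<close> and \<open>QcX_nz\<close> keep Q + c z nonzero at z = Q/X_i and
  z = X_i.\<close>

locale generic =
  fixes Q c :: "'a::field" and X :: "nat \<Rightarrow> 'a" and I :: "nat set"
  assumes Q_nz: "Q \<noteq> 0"
    and inj_X: "inj_on X I"
    and X_nz: "\<And>i. i \<in> I \<Longrightarrow> X i \<noteq> 0"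
    and QX_nz: "\<And>i. i \<in> I \<Longrightarrow> Q + X i \<noteq> 0"
    and cX_nz: "\<And>i. i \<in> I \<Longrightarrow> c + X i \<noteq> 0"
    and QcX_nz: "\<And>i. i \<in> I \<Longrightarrow> Q + c * X i \<noteq> 0"
    and QXX_nz: "\<And>i j. i \<in> I \<Longrightarrow> j \<in> I \<Longrightarrow> Q - X i * X j \<noteq> 0"
    and mixed_nz: "\<And>i j. i \<in> I \<Longrightarrow> j \<in> I \<Longrightarrow> mixed_factor Q c (X i) (X j) \<noteq> 0"
    and inner_nz: "\<And>i j. i \<in> I \<Longrightarrow> j \<in> I \<Longrightarrow> inner_factor Q c (X i) (X j) \<noteq> 0"

lemma generic_mono: "generic Q c X I \<Longrightarrow> J \<subseteq> I \<Longrightarrow> generic Q c X J"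
  unfolding generic_def by (meson inj_on_subset subsetD)

text \<open>
  Each factor on the right-hand side is the value at $s = s_i$ of the linear fractional function
  $t_j(s) = \frac{(Q - c X_j^2) - s X_j (1 + X_j)}{(X_j^2 - Q c) - s (Q + X_j)}$ with pole $s_j$. Since
  $t_j(\infty) = X_j (1 + X_j) / (Q + X_j)$ and $t_j(-1-c) = 1$ for all $j$, the identity is the partial
  fraction decomposition of $\prod_j t_j$, evaluated at $s = -1-c$.
\<close>

lemma (in generic) one_minus_prod_weight:
  assumes fin: "finite I"
  shows "1 - (\<Prod>i\<in>I. weight Q (X i))
    = (\<Sum>i\<in>I. (Q - X i * X i) / (Q + X i) *
        (\<Prod>j\<in>I - {i}. mixed_factor Q c (X j) (X i) * (Q - X i * X j) / ((X j - X i) * inner_factor Q c (X i) (X j))))"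
proof -
  define s where "s i = (X i * X i - Q * c) / (Q + X i)" for i
  define e where "e i = (Q - X i * X i) * mixed_factor Q c (X i) (X i) / (Q + X i) ^ 2" for i
  define t where "t i z = weight Q (X i) + e i / (s i - z)" for i z
  have s_diff: "s j - s i = (X j - X i) * inner_factor Q c (X i) (X j) / ((Q + X i) * (Q + X j))"
    if "i \<in> I" "j \<in> I" for i j
    using QX_nz[OF that(1)] QX_nz[OF that(2)] unfolding s_def inner_factor_def
    by (simp add: divide_simps) (simp add: algebra_simps)
  have s_pt: "s i - (- (1 + c)) = mixed_factor Q c (X i) (X i) / (Q + X i)" if "i \<in> I" for i
    using QX_nz[OF that] unfolding s_def mixed_factor_def by (simp add: divide_simps) (simp add: algebra_simps)
  have inj: "inj_on s I"
  proof (rule inj_onI, rule ccontr)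
    fix i j assume ij: "i \<in> I" "j \<in> I" "s i = s j" "i \<noteq> j"
    have "X j - X i \<noteq> 0" using ij inj_X by (auto simp: inj_on_def)
    thus False using s_diff[of i j] ij inner_nz[of i j] QX_nz[of i] QX_nz[of j] by simp
  qed
  have ne: "s i \<noteq> - (1 + c)" if "i \<in> I" for i
    using s_pt[OF that] mixed_nz[OF that that] QX_nz[OF that] by auto
  have t1: "t i (- (1 + c)) = 1" if "i \<in> I" for i
  proof -
    have "e i / (s i - (- (1 + c))) = (Q - X i * X i) / (Q + X i)"
      unfolding s_pt[OF that] e_def using mixed_nz[OF that that] QX_nz[OF that]
      by (simp add: power2_eq_square)
    thus ?thesis unfolding t_def weight_def using QX_nz[OF that] by (simp add: field_simps)
  qed
  have t2: "t j (s i) = mixed_factor Q c (X j) (X i) * (Q - X i * X j) / ((X j - X i) * inner_factor Q c (X i) (X j))"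
    if "i \<in> I" "j \<in> I" "i \<noteq> j" for i j
  proof -
    have nz: "X j - X i \<noteq> 0" "inner_factor Q c (X i) (X j) \<noteq> 0" "Q + X i \<noteq> 0" "Q + X j \<noteq> 0"
      using that inj_X inner_nz QX_nz by (auto simp: inj_on_def)
    have "t j (s i) = weight Q (X j) + (Q - X j * X j) * mixed_factor Q c (X j) (X j) * (Q + X i)
        / ((Q + X j) * ((X j - X i) * inner_factor Q c (X i) (X j)))"
      unfolding t_def s_diff[OF that(1,2)] e_def using nz
      by (simp add: power2_eq_square)
    also have "\<dots> = (X j * (1 + X j) * ((X j - X i) * inner_factor Q c (X i) (X j))
        + (Q - X j * X j) * mixed_factor Q c (X j) (X j) * (Q + X i))
        / ((Q + X j) * ((X j - X i) * inner_factor Q c (X i) (X j)))"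
      unfolding weight_def using nz by (simp add: add_divide_distrib)
    also have "X j * (1 + X j) * ((X j - X i) * inner_factor Q c (X i) (X j))
        + (Q - X j * X j) * mixed_factor Q c (X j) (X j) * (Q + X i)
        = (Q + X j) * (mixed_factor Q c (X j) (X i) * (Q - X i * X j))"
      unfolding inner_factor_def mixed_factor_def by (simp add: algebra_simps)
    finally show ?thesis using nz by simp
  qed
  have "(\<Prod>j\<in>I. t j (- (1 + c))) = (\<Prod>j\<in>I. weight Q (X j))
      + (\<Sum>i\<in>I. e i / (s i - (- (1 + c))) * (\<Prod>j\<in>I - {i}. t j (s i)))"
    unfolding t_def using fin inj ne by (rule prod_partial_fractions)
  hence "1 - (\<Prod>i\<in>I. weight Q (X i))
      = (\<Sum>i\<in>I. e i / (s i - (- (1 + c))) * (\<Prod>j\<in>I - {i}. t j (s i)))"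
    using t1 by (simp add: algebra_simps)
  also have "\<dots> = (\<Sum>i\<in>I. (Q - X i * X i) / (Q + X i) *
        (\<Prod>j\<in>I - {i}. mixed_factor Q c (X j) (X i) * (Q - X i * X j) / ((X j - X i) * inner_factor Q c (X i) (X j))))"
  proof (intro sum.cong refl, goal_cases)
    case (1 i)
    have "e i / (s i - (- (1 + c))) = (Q - X i * X i) / (Q + X i)"
      unfolding s_pt[OF 1] e_def using mixed_nz[OF 1 1] QX_nz[OF 1]
      by (simp add: power2_eq_square)
    moreover have "(\<Prod>j\<in>I - {i}. t j (s i)) = (\<Prod>j\<in>I - {i}. mixed_factor Q c (X j) (X i) * (Q - X i * X j) / ((X j - X i) * inner_factor Q c (X i) (X j)))"
      using 1 by (intro prod.cong refl t2) auto
    ultimately show ?case by simp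
  qed
  finally show ?thesis .
qed

section \<open>Row expansion and Vandermonde determinants\<close>

text \<open>Multilinearity in the rows: each Leibniz product is expanded by choosing a summand in
  every row, and the choices are pulled outside the sum over permutations.\<close>

lemma det_mat_add:
  fixes f g :: "nat \<Rightarrow> nat \<Rightarrow> 'a::comm_ring_1"
  shows "det (mat n n (\<lambda>(i, j). f i j + g i j))
    = (\<Sum>S\<in>Pow {..<n}. det (mat n n (\<lambda>(i, j). if i \<in> S then f i j else g i j)))"
proof -
  have *: "(\<Prod>i<n. f i (p i) + g i (p i))
      = (\<Sum>S\<in>Pow {..<n}. \<Prod>i<n. if i \<in> S then f i (p i) else g i (p i))" for p
    unfolding prod_add[OF finite_lessThan]
  proof (intro sum.cong refl, goal_cases)
    case (1 S)
    have "(\<Prod>i<n. if i \<in> S then f i (p i) else g i (p i))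
        = (\<Prod>i\<in>{..<n} \<inter> S. f i (p i)) * (\<Prod>i\<in>{..<n} - S. g i (p i))"
      by (simp add: prod.If_cases Diff_eq)
    also have "{..<n} \<inter> S = S" using 1 by auto
    finally show ?case by simp
  qed
  have "det (mat n n (\<lambda>(i, j). f i j + g i j))
      = (\<Sum>p | p permutes {0..<n}. \<Sum>S\<in>Pow {..<n}.
          signof p * (\<Prod>i<n. if i \<in> S then f i (p i) else g i (p i)))"
    by (subst det_def'[of _ n]) (auto simp: atLeast0LessThan * simp flip: sum_distrib_left
        intro!: sum.cong prod.cong)
  also have "\<dots> = (\<Sum>S\<in>Pow {..<n}. \<Sum>p | p permutes {0..<n}.
          signof p * (\<Prod>i<n. if i \<in> S then f i (p i) else g i (p i)))"
    by (rule sum.swap)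
  also have "\<dots> = (\<Sum>S\<in>Pow {..<n}. det (mat n n (\<lambda>(i, j). if i \<in> S then f i j else g i j)))"
    by (intro sum.cong refl, subst det_def'[of _ n]) (auto simp: atLeast0LessThan intro!: sum.cong prod.cong)
  finally show ?thesis .
qed

lemma det_mat_scale_rows:
  fixes f :: "nat \<Rightarrow> nat \<Rightarrow> 'a::comm_ring_1"
  shows "det (mat n n (\<lambda>(i, j). a i * f i j)) = (\<Prod>i<n. a i) * det (mat n n (\<lambda>(i, j). f i j))"
  by (subst (1 2) det_def'[of _ n])
     (auto simp: atLeast0LessThan prod.distrib sum_distrib_left algebra_simps intro!: sum.cong)

lemma prod_pairs_lessThan:
  fixes p :: "nat \<Rightarrow> nat \<Rightarrow> 'a::comm_monoid_mult"
  shows "(\<Prod>(i, j)\<in>pairs {..<n}. p i j) = (\<Prod>j<n. \<Prod>i<j. p i j)"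
proof -
  have "(\<Prod>j<n. \<Prod>i<j. p i j) = (\<Prod>(j, i)\<in>Sigma {..<n} (\<lambda>j. {..<j}). p i j)"
    by (subst prod.Sigma) auto
  also have "\<dots> = (\<Prod>(i, j)\<in>pairs {..<n}. p i j)"
    by (rule prod.reindex_bij_witness[of _ prod.swap prod.swap]) (auto simp: pairs_def)
  finally show ?thesis by simp
qed

text \<open>Factor the Newton basis matrix, which is triangular, through the monomial basis.\<close>

lemma det_vandermonde:
  fixes x :: "nat \<Rightarrow> 'a::idom"
  shows "det (mat n n (\<lambda>(i, j). x i ^ j)) = (\<Prod>(i, j)\<in>pairs {..<n}. x j - x i)"
proof -
  define N where "N j = (\<Prod>k<j. [:- x k, 1:])" for j
  have deg: "degree (N j) = j" for j
    unfolding N_def by (subst degree_prod_eq_sum_degree) auto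
  have lead: "coeff (N j) j = 1" for j
    using lead_coeff_prod[of "\<lambda>k. [:- x k, 1:]" "{..<j}"] deg[of j] by (simp add: N_def)
  define V where "V = mat n n (\<lambda>(i, j). x i ^ j)"
  define U where "U = mat n n (\<lambda>(k, j). coeff (N j) k)"
  define A where "A = mat n n (\<lambda>(i, j). poly (N j) (x i))"
  have "A = V * U"
  proof (rule eq_matI)
    fix i j assume ij: "i < dim_row (V * U)" "j < dim_col (V * U)"
    hence "poly (N j) (x i) = (\<Sum>k<n. coeff (N j) k * x i ^ k)"
      unfolding poly_altdef by (intro sum.mono_neutral_left) (auto simp: U_def V_def deg coeff_eq_0)
    with ij show "A $$ (i, j) = (V * U) $$ (i, j)"
      by (simp add: A_def U_def V_def scalar_prod_def atLeast0LessThan mult.commute)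
  qed (simp_all add: A_def V_def U_def)
  moreover have "V \<in> carrier_mat n n" "U \<in> carrier_mat n n"
    by (simp_all add: V_def U_def)
  ultimately have "det A = det V * det U"
    by (simp add: det_mult[of V n U])
  also have "det U = 1"
    by (subst det_upper_triangular[of U n])
       (auto simp: U_def prod_list_diag_prod lead deg coeff_eq_0 upper_triangular_def)
  also have "det A = (\<Prod>j<n. poly (N j) (x j))"
    by (subst det_lower_triangular[of n A])
       (auto simp: A_def prod_list_diag_prod N_def poly_prod atLeast0LessThan)
  also have "\<dots> = (\<Prod>(i, j)\<in>pairs {..<n}. x j - x i)"
    by (simp add: prod_pairs_lessThan N_def poly_prod)
  finally show ?thesis by (simp add: V_def)
qed

text \<open>Taking \<open>v i ^ (n - 1)\<close> out of row \<open>i\<close> leaves a Vandermonde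
  matrix with nodes \<open>u i / v i\<close>. Each pair then absorbs one factor
  \<open>v i * v j\<close>, which clears its denominators.\<close>

lemma det_homogeneous_vandermonde:
  fixes u v :: "nat \<Rightarrow> 'a::field"
  assumes v: "\<And>i. i < n \<Longrightarrow> v i \<noteq> 0"
  shows "det (mat n n (\<lambda>(i, j). u i ^ j * v i ^ (n - 1 - j)))
    = (\<Prod>(i, j)\<in>pairs {..<n}. u j * v i - u i * v j)"
proof -
  have "mat n n (\<lambda>(i, j). u i ^ j * v i ^ (n - 1 - j))
      = mat n n (\<lambda>(i, j). v i ^ (n - 1) * (u i / v i) ^ j)"
    using v by (intro cong_mat) (auto simp: power_divide power_diff)
  hence "det (mat n n (\<lambda>(i, j). u i ^ j * v i ^ (n - 1 - j)))
      = (\<Prod>i<n. v i ^ (n - 1)) * (\<Prod>(i, j)\<in>pairs {..<n}. u j / v j - u i / v i)"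
    by (simp add: det_mat_scale_rows det_vandermonde)
  also have "(\<Prod>i<n. v i ^ (n - 1)) = (\<Prod>(i, j)\<in>pairs {..<n}. v i * v j)"
    by (simp add: prod_pairs_weights)
  also have "\<dots> * (\<Prod>(i, j)\<in>pairs {..<n}. u j / v j - u i / v i)
      = (\<Prod>(i, j)\<in>pairs {..<n}. u j * v i - u i * v j)"
    unfolding prod.distrib[symmetric] using v
    by (intro prod.cong refl) (auto simp: pairs_def field_simps)
  finally show ?thesis .
qed

section \<open>Antisymmetry under x -> Q/x and a vanishing determinant\<close>

text \<open>The reflection exchanges the degrees k and 2n - k up to a scalar, and the middle degree
  n cancels. Degrees 0 and 2n are absent by hypothesis, so only n - 1 functions of \<open>x\<close>
  occur; this is the rank bound for the determinant below.\<close>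

lemma poly_minus_reciprocal:
  fixes p :: "'a::field poly"
  assumes deg: "degree p < 2 * n" and p0: "coeff p 0 = 0" and nz: "Q \<noteq> 0" "x \<noteq> 0"
  shows "poly p x - x ^ (2 * n) / Q ^ n * poly p (Q / x)
    = (\<Sum>k=1..<n. (x ^ k - x ^ (2 * n - k) / Q ^ (n - k))
        * (coeff p k - Q ^ (n - k) * coeff p (2 * n - k)))"
proof -
  define F where "F k = coeff p k * (x ^ k - x ^ (2 * n) / Q ^ n * (Q / x) ^ k)" for k
  have n: "n \<ge> 1" using deg by simp
  have P: "poly p z = (\<Sum>k=1..<2*n. coeff p k * z ^ k)" for z
  proof -
    have "(\<Sum>k=1..<2*n. coeff p k * z ^ k) = (\<Sum>k<2*n. coeff p k * z ^ k)"
      by (intro sum.mono_neutral_left) (auto simp: p0 not_le)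
    also have "\<dots> = (\<Sum>k\<le>degree p. coeff p k * z ^ k)"
      by (intro sum.mono_neutral_right) (use deg in \<open>auto simp: coeff_eq_0\<close>)
    finally show ?thesis by (simp add: poly_altdef)
  qed
  have split: "{1..<2*n} = {1..<n} \<union> (insert n {n+1..<2*n})" using n by auto
  have "poly p x - x ^ (2 * n) / Q ^ n * poly p (Q / x) = (\<Sum>k=1..<2*n. F k)"
    unfolding P F_def by (simp add: sum_distrib_left sum_subtractf algebra_simps)
  also have "\<dots> = (\<Sum>k=1..<n. F k) + (F n + (\<Sum>k=n+1..<2*n. F k))"
    unfolding split by (subst sum.union_disjoint) auto
  also have "(\<Sum>k=n+1..<2*n. F k) = (\<Sum>k=1..<n. F (2 * n - k))"
    by (rule sum.reindex_bij_witness[of _ "\<lambda>k. 2 * n - k" "\<lambda>k. 2 * n - k"]) auto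
  also have "F n = 0"
    using nz by (simp add: F_def power_divide mult_2 power_add)
  also have "(\<Sum>k=1..<n. F k) + (0 + (\<Sum>k=1..<n. F (2 * n - k)))
      = (\<Sum>k=1..<n. (x ^ k - x ^ (2 * n - k) / Q ^ (n - k))
        * (coeff p k - Q ^ (n - k) * coeff p (2 * n - k)))"
    unfolding add_0 sum.distrib[symmetric]
  proof (intro sum.cong refl, goal_cases)
    case (1 k)
    have kn: "k < n" using 1 by simp
    have e1: "x ^ (2 * n) / Q ^ n * (Q / x) ^ k = x ^ (2 * n - k) / Q ^ (n - k)"
      using nz kn by (simp add: power_divide power_diff)
    have "x ^ (2 * n) / Q ^ n * (Q / x) ^ (2 * n - k) = Q ^ (2 * n - k) / Q ^ n * (x ^ (2 * n) / x ^ (2 * n - k))"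
      by (simp add: power_divide)
    also have "Q ^ (2 * n - k) / Q ^ n = Q ^ (n - k)"
      using nz kn by (simp flip: power_diff)
    also have "x ^ (2 * n) / x ^ (2 * n - k) = x ^ k"
      using nz kn by (simp flip: power_diff)
    finally have e2: "x ^ (2 * n) / Q ^ n * (Q / x) ^ (2 * n - k) = Q ^ (n - k) * x ^ k" .
    have ring: "a * (X - D) + b * (E - q * X) = (X - D) * (a - q * b)" if "q * D = E"
      for a b X D E q :: 'a
      unfolding that[symmetric] by (simp add: algebra_simps)
    show ?case unfolding F_def e1 e2
      by (rule ring) (use nz in simp)
  qed
  finally show ?thesis .
qed

text \<open>Up to the factor \<open>x\<close>, homogeneous of degree n - 1 in x (1 + x) and Q + c x,
  so that its values at n points form a homogeneous Vandermonde matrix with scaled rows.\<close>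

definition basis_fun :: "nat \<Rightarrow> 'a::field \<Rightarrow> 'a \<Rightarrow> nat \<Rightarrow> 'a \<Rightarrow> 'a" where
  "basis_fun n Q c j x = x * ((x * (1 + x)) ^ j * (Q + c * x) ^ (n - 1 - j))"

text \<open>
  The entries in a row are values of $n$ polynomials in the $(n-1)$-dimensional space of polynomials of
  degree less than $2n$, without constant term, that are antisymmetric under
  $p(x) \mapsto x^{2n} Q^{-n} p(Q/x)$.
\<close>

lemma det_minus_reciprocal_eq_0:
  fixes x :: "nat \<Rightarrow> 'a::field"
  assumes n: "n \<ge> 1" and Q: "Q \<noteq> 0" and x: "\<And>i. i < n \<Longrightarrow> x i \<noteq> 0"
  shows "det (mat n n (\<lambda>(i, j).
    basis_fun n Q c j (x i) - x i ^ (2 * n) / Q ^ n * basis_fun n Q c j (Q / x i))) = 0"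
proof -
  define p where "p j = [:0, 1:] * ([:0, 1, 1:] ^ j * [:Q, c:] ^ (n - 1 - j))" for j
  have pb: "poly (p j) z = basis_fun n Q c j z" for j z
    by (simp add: p_def basis_fun_def algebra_simps)
  have deg: "degree (p j) < 2 * n" if "j < n" for j
  proof -
    have "degree (p j) \<le> 1 + (2 * j + 1 * (n - 1 - j))"
      unfolding p_def
      by (intro order.trans[OF degree_mult_le] add_mono order.trans[OF degree_power_le] mult_mono)
         auto
    thus ?thesis using that by simp
  qed
  have p0: "coeff (p j) 0 = 0" for j
    by (simp add: p_def coeff_mult)
  \<comment> \<open>Only n - 1 functions are available. The zero column \<open>k = 0\<close> pads
    the matrix to a square one, so that \<open>det_mult\<close> applies and \<open>det A\<close>
    vanishes.\<close>
  define A where "A = mat n n (\<lambda>(i, k). if k = 0 then 0 else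
    x i ^ k - x i ^ (2 * n - k) / Q ^ (n - k))"
  define B where "B = mat n n (\<lambda>(k, j). coeff (p j) k - Q ^ (n - k) * coeff (p j) (2 * n - k))"
  have "mat n n (\<lambda>(i, j). basis_fun n Q c j (x i) - x i ^ (2 * n) / Q ^ n * basis_fun n Q c j (Q / x i))
      = A * B"
  proof (rule eq_matI)
    fix i j assume ij: "i < dim_row (A * B)" "j < dim_col (A * B)"
    hence ij': "i < n" "j < n" by (auto simp: A_def B_def)
    have "{0..<n} = insert 0 {1..<n}" using n by auto
    thus "mat n n (\<lambda>(i, j). basis_fun n Q c j (x i) - x i ^ (2 * n) / Q ^ n * basis_fun n Q c j (Q / x i)) $$ (i, j)
        = (A * B) $$ (i, j)"
      using ij' poly_minus_reciprocal[OF deg[OF ij'(2)] p0 Q x[OF ij'(1)]]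
      by (simp add: A_def B_def scalar_prod_def pb)
  qed (simp_all add: A_def B_def)
  moreover have "det A = 0"
  proof -
    have "(\<Prod>j<n. A $$ (s j, j)) = 0" if "s permutes {0..<n}" for s
    proof (rule prod_zero)
      have "s 0 < n" using permutes_in_image[OF that, of 0] n by simp
      thus "\<exists>j\<in>{..<n}. A $$ (s j, j) = 0" using n by (intro bexI[of _ 0]) (auto simp: A_def)
    qed auto
    thus ?thesis by (subst det_col[of A n]) (auto simp: A_def intro!: sum.neutral)
  qed
  moreover have "A \<in> carrier_mat n n" "B \<in> carrier_mat n n"
    by (simp_all add: A_def B_def)
  ultimately show ?thesis
    by (simp add: det_mult[of A n B])
qed

section \<open>Expansion of the determinant over subsets of the rows\<close>

text \<open>
  Up to monomial factors, this is the $(i,j)$ factor of the Vandermonde-type determinant in which the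
  variables $X_i$ with $i \in S$ are replaced by $Q/X_i$, divided by $(X_j - X_i)(Q - X_i X_j)$.
\<close>

definition pair_weight :: "'a::field \<Rightarrow> 'a \<Rightarrow> (nat \<Rightarrow> 'a) \<Rightarrow> nat set \<Rightarrow> nat \<Rightarrow> nat \<Rightarrow> 'a" where
  "pair_weight Q c X S i j =
     (if i \<in> S then
        if j \<in> S then - inner_factor Q c (X i) (X j) / (Q - X i * X j)
        else mixed_factor Q c (X j) (X i) / (X i - X j)
      else
        if j \<in> S then mixed_factor Q c (X i) (X j) / (X j - X i)
        else outer_factor Q c (X i) (X j) / (Q - X i * X j))"

lemma pair_weight_commute: "pair_weight Q c X S i j = pair_weight Q c X S j i"
  by (simp add: pair_weight_def inner_factor_def outer_factor_def algebra_simps)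

text \<open>\<open>S\<close> records the rows in which the reflected summand is chosen; each of them
  contributes one sign.\<close>

definition subset_coeff :: "'a::field \<Rightarrow> 'a \<Rightarrow> (nat \<Rightarrow> 'a) \<Rightarrow> nat set \<Rightarrow> nat set \<Rightarrow> 'a" where
  "subset_coeff Q c X I S = (-1) ^ card S * (\<Prod>i\<in>I. (Q + X i) / (Q - X i * X i))
     * (\<Prod>(i, j)\<in>pairs I. pair_weight Q c X S i j)"

text \<open>\<open>M\<close> stands for m + 1, so that the initial value m = -1 becomes
  \<open>M = 0\<close>.\<close>

definition subset_sum :: "'a::field \<Rightarrow> 'a \<Rightarrow> (nat \<Rightarrow> 'a) \<Rightarrow> nat set \<Rightarrow> nat \<Rightarrow> 'a" where
  "subset_sum Q c X I M = (\<Sum>S\<in>Pow I. (\<Prod>i\<in>S. weight Q (X i)) ^ M * subset_coeff Q c X I S)"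

text \<open>An increasing relabelling carries pairs to pairs. This transfers the determinant formula
  from \<open>{..<n}\<close> to arbitrary finite index sets.\<close>

lemma subset_sum_reindex:
  assumes e: "strict_mono_on A e"
  shows "subset_sum Q c X (e ` A) M = subset_sum Q c (X \<circ> e) A M"
proof -
  have inj: "inj_on e A" using e by (rule strict_mono_on_imp_inj_on)
  have less: "e i < e j \<longleftrightarrow> i < j" if "i \<in> A" "j \<in> A" for i j
    using e that by (simp add: strict_mono_on_less)
  have mem: "e i \<in> e ` S \<longleftrightarrow> i \<in> S" if "i \<in> A" "S \<subseteq> A" for i S
    using that inj by (simp add: inj_on_image_mem_iff)
  have pairs: "pairs (e ` A) = map_prod e e ` pairs A"
    by (auto simp: pairs_def less image_iff)
  have injp: "inj_on (map_prod e e) (pairs A)"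
    by (rule inj_on_subset[OF map_prod_inj_on[OF inj inj]]) (auto simp: pairs_def)
  have subset_coeff: "subset_coeff Q c X (e ` A) (e ` S) = subset_coeff Q c (X \<circ> e) A S" if S: "S \<subseteq> A" for S
  proof -
    have "card (e ` S) = card S" using inj S by (meson card_image inj_on_subset)
    moreover have "(\<Prod>i\<in>e ` A. (Q + X i) / (Q - X i * X i))
        = (\<Prod>i\<in>A. (Q + (X \<circ> e) i) / (Q - (X \<circ> e) i * (X \<circ> e) i))"
      by (simp add: prod.reindex[OF inj] o_def)
    moreover have "(\<Prod>(i, j)\<in>pairs (e ` A). pair_weight Q c X (e ` S) i j)
        = (\<Prod>(i, j)\<in>pairs A. pair_weight Q c (X \<circ> e) S i j)"
      unfolding pairs prod.reindex[OF injp] using S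
      by (intro prod.cong refl) (auto simp: pairs_def pair_weight_def mem)
    ultimately show ?thesis by (simp add: subset_coeff_def)
  qed
  have "subset_sum Q c X (e ` A) M
      = (\<Sum>S\<in>Pow A. (\<Prod>i\<in>e ` S. weight Q (X i)) ^ M * subset_coeff Q c X (e ` A) (e ` S))"
    unfolding subset_sum_def image_Pow_surj[OF refl, symmetric]
    by (subst sum.reindex[OF inj_on_image_Pow[OF inj]]) simp
  also have "\<dots> = subset_sum Q c (X \<circ> e) A M"
    unfolding subset_sum_def
  proof (intro sum.cong refl, goal_cases)
    case (1 S)
    hence "inj_on e S" using inj by (auto intro: inj_on_subset)
    thus ?case using 1 by (simp add: subset_coeff prod.reindex)
  qed
  finally show ?thesis .
qed

lemma generic_reindex:
  assumes "generic Q c X (e ` A)" "inj_on e A"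
  shows "generic Q c (X \<circ> e) A"
  using assms unfolding generic_def by (auto simp: comp_inj_on)

text \<open>Multilinearity chooses the point X_i or Q/X_i in each row, and every choice leaves a
  homogeneous Vandermonde determinant. Divided by the denominators, its factors become the pair
  weights.\<close>

lemma subset_sum_eq_det:
  assumes "generic Q c X {..<n}"
  shows "subset_sum Q c X {..<n} M
    = (\<Prod>i<n. (Q + X i) / X i)
      * det (mat n n (\<lambda>(i, j). basis_fun n Q c j (X i)
          - X i ^ (2 * n) / Q ^ n * weight Q (X i) ^ M * basis_fun n Q c j (Q / X i)))
      / ((\<Prod>i<n. Q - X i * X i) * (\<Prod>(i, j)\<in>pairs {..<n}. Q - X i * X j)
        * (\<Prod>(i, j)\<in>pairs {..<n}. X j - X i))"
proof -
  interpret generic Q c X "{..<n}" by fact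
  define V where "V = (\<Prod>(i, j)\<in>pairs {..<n}. X j - X i)"
  define D where "D = (\<Prod>(i, j)\<in>pairs {..<n}. Q - X i * X j)"
  define D2 where "D2 = (\<Prod>i<n. Q - X i * X i)"
  define k where "k i = X i ^ (2 * n) / Q ^ n * weight Q (X i) ^ M" for i
  have X: "X i \<noteq> 0" "Q + X i \<noteq> 0" "c + X i \<noteq> 0" "Q + c * X i \<noteq> 0" if "i < n" for i
    using that X_nz QX_nz cX_nz QcX_nz by auto
  have V: "V \<noteq> 0"
  proof -
    have "X j - X i \<noteq> 0" if "(i, j) \<in> pairs {..<n}" for i j
      using that inj_X by (auto simp: pairs_def inj_on_def)
    thus ?thesis by (auto simp: V_def)
  qed
  have D: "D \<noteq> 0"
  proof -
    have "Q - X i * X j \<noteq> 0" if "(i, j) \<in> pairs {..<n}" for i j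
      using that by (intro QXX_nz) (auto simp: pairs_def)
    thus ?thesis by (auto simp: D_def)
  qed
  have D2: "D2 \<noteq> 0"
    using QXX_nz by (auto simp: D2_def)
  have summand: "(\<Prod>i<n. (Q + X i) / X i)
      * det (mat n n (\<lambda>(i, j). if i \<in> S then - k i * basis_fun n Q c j (Q / X i) else basis_fun n Q c j (X i)))
      = (\<Prod>i\<in>S. weight Q (X i)) ^ M * subset_coeff Q c X {..<n} S * (D2 * D * V)"
    if S: "S \<subseteq> {..<n}" for S
  proof -
    \<comment> \<open>\<open>z\<close> lists the chosen points and \<open>a\<close> the row scalars;
      \<open>w i * w j\<close> is the monomial that separates a Vandermonde factor from
      \<open>pair_weight\<close> times its two denominators.\<close>
    define z where "z i = (if i \<in> S then Q / X i else X i)" for i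
    define a where "a i = (if i \<in> S then - k i else 1)" for i
    define w where "w i = (if i \<in> S then Q / (X i * X i) else 1)" for i
    have z_nz: "Q + c * z i \<noteq> 0" if "i < n" for i
    proof (cases "i \<in> S")
      case True
      have "Q + c * (Q / X i) = Q * (c + X i) / X i"
        using X[OF that] by (simp add: field_simps)
      thus ?thesis using True X[OF that] Q_nz by (simp add: z_def)
    qed (use X[OF that] in \<open>simp add: z_def\<close>)
    have "det (mat n n (\<lambda>(i, j). if i \<in> S then - k i * basis_fun n Q c j (Q / X i) else basis_fun n Q c j (X i)))
        = det (mat n n (\<lambda>(i, j). (a i * z i) * ((z i * (1 + z i)) ^ j * (Q + c * z i) ^ (n - 1 - j))))"
      by (intro arg_cong[of _ _ det] cong_mat refl) (auto simp: a_def z_def basis_fun_def)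
    also have "\<dots> = (\<Prod>i<n. a i * z i) * (\<Prod>(i, j)\<in>pairs {..<n}.
          z j * (1 + z j) * (Q + c * z i) - z i * (1 + z i) * (Q + c * z j))"
      by (subst det_mat_scale_rows, subst det_homogeneous_vandermonde) (use z_nz in auto)
    also have "(\<Prod>(i, j)\<in>pairs {..<n}. z j * (1 + z j) * (Q + c * z i) - z i * (1 + z i) * (Q + c * z j))
        = (\<Prod>(i, j)\<in>pairs {..<n}. (w i * w j) * pair_weight Q c X S i j * (Q - X i * X j) * (X j - X i))"
    proof (intro prod.cong refl, clarify, goal_cases)
      case (1 i j)
      hence ij: "i < n" "j < n" "X j - X i \<noteq> 0" "X i - X j \<noteq> 0" "Q - X i * X j \<noteq> 0"
        using inj_X QXX_nz by (auto simp: pairs_def inj_on_def)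
      note nz = X(1)[OF ij(1)] X(1)[OF ij(2)] ij(3-)
      \<comment> \<open>The expression is antisymmetric in the two points, so their difference
        splits off.\<close>
      have lhs: "z j * (1 + z j) * (Q + c * z i) - z i * (1 + z i) * (Q + c * z j)
          = (z j - z i) * outer_factor Q c (z i) (z j)"
        by (simp add: outer_factor_def algebra_simps)
      consider "i \<in> S" "j \<in> S" | "i \<in> S" "j \<notin> S" | "i \<notin> S" "j \<in> S" | "i \<notin> S" "j \<notin> S" by blast
      thus ?case unfolding lhs
      proof cases
        case 1
        have "Q / X j - Q / X i = - (Q / (X i * X j)) * (X j - X i)"
          using nz by (simp add: field_simps)
        moreover have "outer_factor Q c (Q / X i) (Q / X j) = Q / (X i * X j) * inner_factor Q c (X i) (X j)"
          using nz by (simp add: outer_factor_def inner_factor_def field_simps)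
        ultimately show "(z j - z i) * outer_factor Q c (z i) (z j)
            = w i * w j * pair_weight Q c X S i j * (Q - X i * X j) * (X j - X i)"
          using 1 nz by (simp add: z_def w_def pair_weight_def mult_ac)
      next
        case 2
        have "X j - Q / X i = - (Q - X i * X j) / X i"
          using nz by (simp add: field_simps)
        moreover have "outer_factor Q c (Q / X i) (X j) = Q / X i * mixed_factor Q c (X j) (X i)"
          using nz by (simp add: outer_factor_def mixed_factor_def field_simps)
        moreover have "mixed_factor Q c (X j) (X i) / (X i - X j) * (X j - X i) = - mixed_factor Q c (X j) (X i)"
          using nz by (simp add: field_simps)
        ultimately show "(z j - z i) * outer_factor Q c (z i) (z j)
            = w i * w j * pair_weight Q c X S i j * (Q - X i * X j) * (X j - X i)"
          using 2 nz by (simp add: z_def w_def pair_weight_def mult.assoc)  (simp add: field_simps)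
      next
        case 3
        have "Q / X j - X i = (Q - X i * X j) / X j"
          using nz by (simp add: field_simps)
        moreover have "outer_factor Q c (X i) (Q / X j) = Q / X j * mixed_factor Q c (X i) (X j)"
          using nz by (simp add: outer_factor_def mixed_factor_def field_simps)
        ultimately show "(z j - z i) * outer_factor Q c (z i) (z j)
            = w i * w j * pair_weight Q c X S i j * (Q - X i * X j) * (X j - X i)"
          using 3 nz by (simp add: z_def w_def pair_weight_def)
      next
        case 4
        thus "(z j - z i) * outer_factor Q c (z i) (z j)
            = w i * w j * pair_weight Q c X S i j * (Q - X i * X j) * (X j - X i)"
          using nz by (simp add: z_def w_def pair_weight_def)
      qed
    qed
    also have "\<dots> = (\<Prod>(i, j)\<in>pairs {..<n}. w i * w j)
        * (\<Prod>(i, j)\<in>pairs {..<n}. pair_weight Q c X S i j) * D * V"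
      by (simp add: D_def V_def case_prod_unfold prod.distrib)
    also have "(\<Prod>(i, j)\<in>pairs {..<n}. w i * w j) = (\<Prod>i<n. w i ^ (n - 1))"
      by (simp add: prod_pairs_weights)
    finally have "(\<Prod>i<n. (Q + X i) / X i)
        * det (mat n n (\<lambda>(i, j). if i \<in> S then - k i * basis_fun n Q c j (Q / X i) else basis_fun n Q c j (X i)))
        = (\<Prod>i<n. (Q + X i) / X i * (a i * z i) * w i ^ (n - 1))
          * (\<Prod>(i, j)\<in>pairs {..<n}. pair_weight Q c X S i j) * D * V"
      by (simp only: prod.distrib mult_ac)
    also have "(\<Prod>i<n. (Q + X i) / X i * (a i * z i) * w i ^ (n - 1))
        = (\<Prod>i<n. (Q + X i) * (if i \<in> S then - (weight Q (X i) ^ M) else 1))"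
    proof (intro prod.cong refl, goal_cases)
      case (1 i)
      hence i: "i < n" by simp
      show ?case
      proof (cases "i \<in> S")
        case True
        obtain d where n: "n = Suc d" using i by (cases n) auto
        \<comment> \<open>The powers met in a reflected row, (X_i^2/Q)^n from the prefactor, Q/X_i
          from \<open>z i\<close> and (Q/X_i^2)^(n-1) from the pairs, cancel to X_i.\<close>
        have "X i ^ (2 * n) = X i * X i * (X i * X i) ^ d"
          by (simp add: n power_mult power2_eq_square)
        hence "X i ^ (2 * n) / Q ^ n * (Q / X i) * (Q / (X i * X i)) ^ (n - 1) = X i"
          using X[OF i] Q_nz by (simp add: n power_divide)
        hence 1: "(Q + X i) / X i * (X i ^ (2 * n) / Q ^ n * (Q / X i) * (Q / (X i * X i)) ^ (n - 1))
            = Q + X i"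
          using X[OF i] by simp
        have "(Q + X i) / X i * (- k i * (Q / X i)) * (Q / (X i * X i)) ^ (n - 1)
            = - ((Q + X i) / X i * (X i ^ (2 * n) / Q ^ n * (Q / X i) * (Q / (X i * X i)) ^ (n - 1))
              * weight Q (X i) ^ M)"
          by (simp only: k_def mult_minus_left mult_minus_right mult_ac)
        hence "(Q + X i) / X i * (- k i * (Q / X i)) * (Q / (X i * X i)) ^ (n - 1)
            = (Q + X i) * - (weight Q (X i) ^ M)"
          unfolding 1 by simp
        thus ?thesis using True by (simp only: a_def z_def w_def if_True)
      qed (use X[OF i] in \<open>simp add: a_def z_def w_def\<close>)
    qed
    also have "\<dots> = (\<Prod>i<n. (Q + X i) / (Q - X i * X i)) * D2 * ((-1) ^ card S * (\<Prod>i\<in>S. weight Q (X i)) ^ M)"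
    proof -
      have "(\<Prod>i<n. if i \<in> S then - (weight Q (X i) ^ M) else 1) = (\<Prod>i\<in>S. - (weight Q (X i) ^ M))"
        using S by (subst prod.inter_restrict[symmetric]) (auto simp: Int_absorb1)
      also have "\<dots> = (\<Prod>i\<in>S. (-1) * weight Q (X i) ^ M)" by simp
      also have "\<dots> = (-1) ^ card S * (\<Prod>i\<in>S. weight Q (X i)) ^ M"
        unfolding prod.distrib by (simp add: prod_power_distrib)
      finally show ?thesis using D2 by (simp add: prod.distrib prod_dividef D2_def)
    qed
    finally show ?thesis by (simp add: subset_coeff_def algebra_simps)
  qed
  \<comment> \<open>With the reflected summand written first, the set \<open>S\<close> of
    \<open>det_mat_add\<close> is the set of reflected rows.\<close>
  have "mat n n (\<lambda>(i, j). basis_fun n Q c j (X i) - X i ^ (2 * n) / Q ^ n * weight Q (X i) ^ M * basis_fun n Q c j (Q / X i))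
     = mat n n (\<lambda>(i, j). - k i * basis_fun n Q c j (Q / X i) + basis_fun n Q c j (X i))"
    by (intro cong_mat) (auto simp: k_def)
  hence "(\<Prod>i<n. (Q + X i) / X i)
      * det (mat n n (\<lambda>(i, j). basis_fun n Q c j (X i)
          - X i ^ (2 * n) / Q ^ n * weight Q (X i) ^ M * basis_fun n Q c j (Q / X i)))
      = (\<Sum>S\<in>Pow {..<n}. (\<Prod>i<n. (Q + X i) / X i) *
          det (mat n n (\<lambda>(i, j). if i \<in> S then - k i * basis_fun n Q c j (Q / X i) else basis_fun n Q c j (X i))))"
    by (simp only: det_mat_add sum_distrib_left)
  also have "\<dots> = (\<Sum>S\<in>Pow {..<n}. (\<Prod>i\<in>S. weight Q (X i)) ^ M * subset_coeff Q c X {..<n} S * (D2 * D * V))"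
    by (intro sum.cong refl summand) auto
  also have "\<dots> = subset_sum Q c X {..<n} M * (D2 * D * V)"
    by (simp add: subset_sum_def sum_distrib_right)
  finally show ?thesis using V D D2 by (simp add: D_def D2_def V_def)
qed

section \<open>The recursion for the subset sum\<close>

text \<open>At exponent 0 the weights disappear and every entry is an antisymmetrized value, so
  \<open>det_minus_reciprocal_eq_0\<close> applies after an increasing enumeration of
  \<open>I\<close>.\<close>

lemma subset_sum_0:
  assumes gen: "generic Q c X I" and I: "finite I" "I \<noteq> {}"
  shows "subset_sum Q c X I 0 = 0"
proof -
  obtain e where e: "bij_betw e {..<card I} I" "strict_mono_on {..<card I} e"
    using ex_bij_betw_strict_mono_card[OF I(1)] by blast
  have im: "I = e ` {..<card I}" using e by (simp add: bij_betw_def)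
  have gen': "generic Q c (X \<circ> e) {..<card I}"
    using gen e by (intro generic_reindex) (auto simp: bij_betw_def)
  interpret g: generic Q c "X \<circ> e" "{..<card I}" by fact
  have "card I \<ge> 1" using I by (simp add: Suc_le_eq card_gt_0_iff)
  hence "subset_sum Q c (X \<circ> e) {..<card I} 0 = 0"
    unfolding subset_sum_eq_det[OF gen']
    using det_minus_reciprocal_eq_0[of "card I" Q "X \<circ> e" c] g.Q_nz g.X_nz by simp
  thus ?thesis using subset_sum_reindex[OF e(2), of Q c X 0] im by simp
qed

text \<open>In the term for \<open>i\<close>, the pairs avoiding \<open>i\<close> agree with those
  in \<open>subset_coeff Q c X I S\<close>. A pair from \<open>i\<close> to an index outside
  \<open>S\<close> also matches its pair weight, while one inside \<open>S\<close> differs by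
  \<open>T i j\<close>, the factor in \<open>one_minus_prod_weight\<close>. That identity for the
  index set \<open>S\<close> evaluates the remaining sum.\<close>

lemma subset_coeff_step:
  assumes gen: "generic Q c X I" and I: "finite I" and S: "S \<subseteq> I"
  shows "subset_coeff Q c X I S * ((\<Prod>i\<in>S. weight Q (X i)) - 1)
    = (\<Sum>i\<in>S. (\<Prod>j\<in>I - {i}. mixed_factor Q c (X j) (X i) / (X i - X j)) * subset_coeff Q c X (I - {i}) (S - {i}))"
proof -
  interpret g: generic Q c X I by fact
  define T where "T i j = mixed_factor Q c (X j) (X i) * (Q - X i * X j) / ((X j - X i) * inner_factor Q c (X i) (X j))" for i j
  have finS: "finite S" using I S by (rule rev_finite_subset)
  have main: "(\<Prod>j\<in>I - {i}. mixed_factor Q c (X j) (X i) / (X i - X j)) * subset_coeff Q c X (I - {i}) (S - {i})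
      = - subset_coeff Q c X I S * ((Q - X i * X i) / (Q + X i) * (\<Prod>j\<in>S - {i}. T i j))" if i: "i \<in> S" for i
  proof -
    have iI: "i \<in> I" using i S by auto
    have "mixed_factor Q c (X j) (X i) / (X i - X j) = pair_weight Q c X S i j * (if j \<in> S then T i j else 1)"
      if j: "j \<in> I - {i}" for j
    proof -
      have "X j - X i \<noteq> 0" "X i - X j \<noteq> 0" "Q - X i * X j \<noteq> 0" "inner_factor Q c (X i) (X j) \<noteq> 0"
        using j iI g.inj_X g.QXX_nz g.inner_nz by (auto simp: inj_on_def)
      thus ?thesis using i by (auto simp: pair_weight_def T_def) (simp add: field_simps)
    qed
    hence "(\<Prod>j\<in>I - {i}. mixed_factor Q c (X j) (X i) / (X i - X j))
        = (\<Prod>j\<in>I - {i}. pair_weight Q c X S i j) * (\<Prod>j\<in>I - {i}. if j \<in> S then T i j else 1)"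
      by (simp add: prod.distrib)
    also have "(\<Prod>j\<in>I - {i}. if j \<in> S then T i j else 1) = (\<Prod>j\<in>S - {i}. T i j)"
      using S I by (subst prod.inter_restrict[symmetric]) (auto intro!: prod.cong)
    finally have 1: "(\<Prod>j\<in>I - {i}. mixed_factor Q c (X j) (X i) / (X i - X j))
        = (\<Prod>j\<in>I - {i}. pair_weight Q c X S i j) * (\<Prod>j\<in>S - {i}. T i j)" .
    have 2: "(\<Prod>(a, b)\<in>pairs I. pair_weight Q c X S a b)
        = (\<Prod>j\<in>I - {i}. pair_weight Q c X S i j) * (\<Prod>(a, b)\<in>pairs (I - {i}). pair_weight Q c X S a b)"
      using I iI by (rule prod_pairs_remove) (rule pair_weight_commute)
    have 3: "(\<Prod>(a, b)\<in>pairs (I - {i}). pair_weight Q c X (S - {i}) a b)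
        = (\<Prod>(a, b)\<in>pairs (I - {i}). pair_weight Q c X S a b)"
      by (intro prod.cong refl) (auto simp: pairs_def pair_weight_def)
    have 4: "(-1 :: 'a) ^ card S = - ((-1) ^ card (S - {i}))"
      using i finS by (metis card.remove power_Suc mult_minus1)
    have 5: "(\<Prod>a\<in>I. (Q + X a) / (Q - X a * X a))
        = (Q + X i) / (Q - X i * X i) * (\<Prod>a\<in>I - {i}. (Q + X a) / (Q - X a * X a))"
      using I iI by (rule prod.remove)
    have "Q + X i \<noteq> 0" "Q - X i * X i \<noteq> 0" using g.QX_nz g.QXX_nz iI by auto
    thus ?thesis unfolding subset_coeff_def 1 2 3 4 5 by simp
  qed
  have "(\<Sum>i\<in>S. (\<Prod>j\<in>I - {i}. mixed_factor Q c (X j) (X i) / (X i - X j)) * subset_coeff Q c X (I - {i}) (S - {i}))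
      = - subset_coeff Q c X I S * (\<Sum>i\<in>S. (Q - X i * X i) / (Q + X i) * (\<Prod>j\<in>S - {i}. T i j))"
    unfolding sum_distrib_left by (intro sum.cong refl main)
  also have "(\<Sum>i\<in>S. (Q - X i * X i) / (Q + X i) * (\<Prod>j\<in>S - {i}. T i j)) = 1 - (\<Prod>i\<in>S. weight Q (X i))"
    unfolding T_def using generic.one_minus_prod_weight[OF generic_mono[OF gen S] finS] by simp
  finally show ?thesis by (simp add: algebra_simps)
qed

text \<open>Raising \<open>M\<close> by one multiplies the summand of \<open>S\<close> by its
  product of weights, so the difference is governed by \<open>subset_coeff_step\<close>. Exchanging
  the sums over \<open>S\<close> and over \<open>i\<close> in \<open>S\<close>, then removing
  \<open>i\<close> from \<open>S\<close>, reassembles the subset sums of \<open>I - {i}\<close>. The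
  increment corresponds to a largest exponent equal to \<open>M\<close>.\<close>

lemma subset_sum_Suc:
  assumes gen: "generic Q c X I" and I: "finite I"
  shows "subset_sum Q c X I (Suc M) = subset_sum Q c X I M
    + (\<Sum>i\<in>I. (\<Prod>j\<in>I - {i}. mixed_factor Q c (X j) (X i) / (X i - X j)) * (weight Q (X i) ^ M * subset_sum Q c X (I - {i}) M))"
proof -
  define F where "F i = (\<Prod>j\<in>I - {i}. mixed_factor Q c (X j) (X i) / (X i - X j))" for i
  define Y where "Y S = (\<Prod>i\<in>S. weight Q (X i)) ^ M" for S
  have "subset_sum Q c X I (Suc M) - subset_sum Q c X I M
      = (\<Sum>S\<in>Pow I. Y S * (subset_coeff Q c X I S * ((\<Prod>i\<in>S. weight Q (X i)) - 1)))"
    by (simp add: subset_sum_def Y_def sum_subtractf algebra_simps)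
  \<comment> \<open>Writing \<open>S\<close> as a filtered subset of \<open>I\<close> brings the
    double sum into the shape of \<open>sum.swap_restrict\<close>.\<close>
  also have "\<dots> = (\<Sum>S\<in>Pow I. \<Sum>i\<in>{i\<in>I. i \<in> S}. Y S * (F i * subset_coeff Q c X (I - {i}) (S - {i})))"
  proof (intro sum.cong refl, goal_cases)
    case (1 S)
    hence "{i \<in> I. i \<in> S} = S" by auto
    thus ?case using 1 by (simp add: subset_coeff_step[OF gen I] F_def sum_distrib_left)
  qed
  also have "\<dots> = (\<Sum>i\<in>I. \<Sum>S\<in>{S\<in>Pow I. i \<in> S}. Y S * (F i * subset_coeff Q c X (I - {i}) (S - {i})))"
    using I by (intro sum.swap_restrict) auto
  also have "\<dots> = (\<Sum>i\<in>I. F i * (weight Q (X i) ^ M * subset_sum Q c X (I - {i}) M))"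
  proof (intro sum.cong refl, goal_cases)
    case (1 i)
    have "(\<Sum>S\<in>{S\<in>Pow I. i \<in> S}. Y S * (F i * subset_coeff Q c X (I - {i}) (S - {i})))
        = (\<Sum>S\<in>Pow (I - {i}). F i * (weight Q (X i) ^ M * (Y S * subset_coeff Q c X (I - {i}) S)))"
    proof (rule sum.reindex_bij_witness[of _ "insert i" "\<lambda>S. S - {i}"], goal_cases)
      case (5 S)
      hence "finite S" "i \<in> S" using I by (auto intro: finite_subset)
      hence "Y S = weight Q (X i) ^ M * Y (S - {i})"
        by (simp add: Y_def prod.remove power_mult_distrib)
      thus ?case by (simp add: algebra_simps)
    qed (use 1 in auto)
    thus ?case by (simp add: subset_sum_def Y_def sum_distrib_left)
  qed
  finally show ?thesis by (simp add: F_def algebra_simps)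
qed

section \<open>Sums over orderings of the index set\<close>

text \<open>
  The list enumerates $\sigma(n), \ldots, \sigma(1)$, so that its head carries the largest exponent
  $k_n = l$, and the bound \<open>M\<close> on the exponents is strict.
\<close>

primrec ordering_weight :: "'a::field \<Rightarrow> 'a \<Rightarrow> (nat \<Rightarrow> 'a) \<Rightarrow> nat list \<Rightarrow> nat \<Rightarrow> 'a" where
  "ordering_weight Q c X [] M = 1"
| "ordering_weight Q c X (i # xs) M =
     (\<Prod>j\<in>set xs. mixed_factor Q c (X j) (X i) / (X i - X j))
     * (\<Sum>l<M. weight Q (X i) ^ l * ordering_weight Q c X xs l)"

definition ordering_sum :: "'a::field \<Rightarrow> 'a \<Rightarrow> (nat \<Rightarrow> 'a) \<Rightarrow> nat set \<Rightarrow> nat \<Rightarrow> 'a" where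
  "ordering_sum Q c X I M = (\<Sum>xs\<in>permutations_of_set I. ordering_weight Q c X xs M)"

text \<open>Group the lists by their head \<open>i\<close>: the tail enumerates
  \<open>I - {i}\<close>, so the product attached to the head is the same for all tails.\<close>

lemma ordering_sum_rec:
  assumes I: "finite I" "I \<noteq> {}"
  shows "ordering_sum Q c X I M = (\<Sum>i\<in>I. (\<Prod>j\<in>I - {i}. mixed_factor Q c (X j) (X i) / (X i - X j))
    * (\<Sum>l<M. weight Q (X i) ^ l * ordering_sum Q c X (I - {i}) l))"
proof -
  have "ordering_sum Q c X I M = (\<Sum>i\<in>I. \<Sum>xs\<in>(#) i ` permutations_of_set (I - {i}). ordering_weight Q c X xs M)"
    unfolding ordering_sum_def permutations_of_set_nonempty[OF I(2)]
    using I by (subst sum.UNION_disjoint) auto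
  also have "\<dots> = (\<Sum>i\<in>I. \<Sum>xs\<in>permutations_of_set (I - {i}).
      (\<Prod>j\<in>I - {i}. mixed_factor Q c (X j) (X i) / (X i - X j))
      * (\<Sum>l<M. weight Q (X i) ^ l * ordering_weight Q c X xs l))"
    by (rule sum.cong[OF refl], subst sum.reindex) (auto simp: permutations_of_setD intro!: sum.cong)
  also have "\<dots> = (\<Sum>i\<in>I. (\<Prod>j\<in>I - {i}. mixed_factor Q c (X j) (X i) / (X i - X j))
    * (\<Sum>l<M. weight Q (X i) ^ l * ordering_sum Q c X (I - {i}) l))"
    unfolding ordering_sum_def sum_distrib_left by (subst sum.swap) (rule refl)
  finally show ?thesis .
qed

text \<open>Both sides obey the same recursion in \<open>M\<close>, vanish at \<open>M = 0\<close>
  for nonempty \<open>I\<close>, and are 1 for empty \<open>I\<close>. The outer induction on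
  \<open>card I\<close> keeps the bound arbitrary because smaller index sets occur with every bound
  \<open>l\<close>.\<close>

lemma ordering_sum_eq_subset_sum:
  assumes "generic Q c X I" "finite I"
  shows "ordering_sum Q c X I M = subset_sum Q c X I M"
  using assms
proof (induction "card I" arbitrary: I M rule: less_induct)
  case less
  show ?case
  proof (cases "I = {}")
    case True
    thus ?thesis by (simp add: ordering_sum_def subset_sum_def subset_coeff_def pairs_def)
  next
    case False
    have IH: "ordering_sum Q c X (I - {i}) l = subset_sum Q c X (I - {i}) l" if "i \<in> I" for i l
      using less.prems that
      by (intro less.hyps generic_mono[OF less.prems(1)] psubset_card_mono) auto
    show ?thesis
    proof (induction M)
      case 0
      show ?case using less.prems False by (simp add: ordering_sum_rec subset_sum_0)
    next
      case (Suc M)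
      have "ordering_sum Q c X I (Suc M) = ordering_sum Q c X I M + (\<Sum>i\<in>I. (\<Prod>j\<in>I - {i}. mixed_factor Q c (X j) (X i) / (X i - X j))
          * (weight Q (X i) ^ M * ordering_sum Q c X (I - {i}) M))"
        using less.prems False by (simp add: ordering_sum_rec distrib_left sum.distrib)
      thus ?case using Suc less.prems by (simp add: subset_sum_Suc IH)
    qed
  qed
qed

section \<open>From the antisymmetrizer to orderings\<close>

text \<open>The reversal matches \<open>ordering_weight\<close>, whose head is \<sigma>(n). The list
  determines \<sigma> on \<open>{1..n}\<close>, outside of which \<sigma> is the identity;
  surjectivity follows by counting.\<close>

lemma sum_permutes_eq_sum_permutations_of_set:
  "(\<Sum>\<sigma> | \<sigma> permutes {1..n}. F (rev (map \<sigma> [1..<Suc n]))) = (\<Sum>xs\<in>permutations_of_set {1..n}. F xs)"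
proof -
  let ?g = "\<lambda>\<sigma>. rev (map \<sigma> [1..<Suc n])"
  let ?P = "{\<sigma>. \<sigma> permutes {1..n}}"
  have inj: "inj_on ?g ?P"
  proof (rule inj_onI, rule ext)
    fix \<sigma> \<tau> x assume "\<sigma> \<in> ?P" "\<tau> \<in> ?P" and eq: "?g \<sigma> = ?g \<tau>"
    hence perm: "\<sigma> permutes {1..n}" "\<tau> permutes {1..n}" by auto
    have "map \<sigma> [1..<Suc n] = map \<tau> [1..<Suc n]" using eq by simp
    hence "\<sigma> x = \<tau> x" if "x \<in> {1..n}"
      using that by (simp add: map_eq_conv del: upt_Suc)
    thus "\<sigma> x = \<tau> x" using perm by (cases "x \<in> {1..n}") (auto simp: permutes_not_in)
  qed
  have "?g ` ?P \<subseteq> permutations_of_set {1..n}"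
  proof clarify
    fix \<sigma> assume p: "\<sigma> permutes {1..n}"
    have "\<sigma> ` {1..n} = {1..n}" "inj_on \<sigma> {1..n}"
      using p by (auto simp: permutes_image permutes_inj_on)
    moreover have "set [1..<Suc n] = {1..n}" by auto
    ultimately show "?g \<sigma> \<in> permutations_of_set {1..n}"
      by (intro permutations_of_setI) (auto simp: distinct_map simp del: upt_Suc)
  qed
  moreover have "card (?g ` ?P) = card (permutations_of_set {1..n})"
    using inj by (simp add: card_image card_permutations)
  ultimately have im: "?g ` ?P = permutations_of_set {1..n}"
    by (intro card_subset_eq) auto
  show ?thesis unfolding im[symmetric] sum.reindex[OF inj] o_def ..
qed

text \<open>The bound is exclusive, so that the entries before a largest entry l form a sequence of
  the same kind with bound l, also when l = 0.\<close>

definition strict_seqs :: "nat \<Rightarrow> nat \<Rightarrow> (nat \<Rightarrow> nat) set" where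
  "strict_seqs n M = {k \<in> {1..n} \<rightarrow>\<^sub>E {..<M}. strict_mono_on {1..n} k}"

lemma incr_seqs_eq: "incr_seqs n m = strict_seqs n (Suc m)"
  by (simp add: incr_seqs_def strict_seqs_def atLeast0AtMost lessThan_Suc_atMost)

lemma finite_strict_seqs [simp]: "finite (strict_seqs n M)"
  by (rule finite_subset[of _ "{1..n} \<rightarrow>\<^sub>E {..<M}"]) (auto simp: strict_seqs_def intro!: finite_PiE)

text \<open>The last entry of an increasing sequence is its largest, hence it is an exclusive bound
  for the others.\<close>

lemma sum_strict_seqs_Suc:
  fixes z :: "nat \<Rightarrow> 'a::comm_semiring_1"
  shows "(\<Sum>k\<in>strict_seqs (Suc n) M. \<Prod>i=1..Suc n. z i ^ k i)
    = (\<Sum>l<M. z (Suc n) ^ l * (\<Sum>k\<in>strict_seqs n l. \<Prod>i=1..n. z i ^ k i))"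
proof -
  have "(\<Sum>l<M. z (Suc n) ^ l * (\<Sum>k\<in>strict_seqs n l. \<Prod>i=1..n. z i ^ k i))
      = (\<Sum>(l, k)\<in>(SIGMA l:{..<M}. strict_seqs n l). z (Suc n) ^ l * (\<Prod>i=1..n. z i ^ k i))"
    by (simp add: sum_distrib_left sum.Sigma)
  also have "\<dots> = (\<Sum>k\<in>strict_seqs (Suc n) M. \<Prod>i=1..Suc n. z i ^ k i)"
  \<comment> \<open>Dropping the last entry must reset it to \<open>undefined\<close>, the value of
    extensional functions outside their domain.\<close>
  proof (rule sum.reindex_bij_witness[of _ "\<lambda>k. (k (Suc n), k(Suc n := undefined))"
        "\<lambda>(l, k). k(Suc n := l)"], goal_cases)
    case (1 a)
    then obtain l k where a: "a = (l, k)" "l < M" "k \<in> strict_seqs n l" by auto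
    hence "k (Suc n) = undefined" by (auto simp: strict_seqs_def PiE_def extensional_def)
    thus ?case using a by (auto simp: fun_upd_idem)
  next
    case (2 a)
    then obtain l k where a: "a = (l, k)" "l < M" "k \<in> strict_seqs n l" by auto
    have k: "k i < l" if "i \<in> {1..n}" for i
      using a that by (auto simp: strict_seqs_def PiE_def Pi_def)
    have mono: "k i < k j" if "i \<in> {1..n}" "j \<in> {1..n}" "i < j" for i j
      using a that by (auto simp: strict_seqs_def strict_mono_on_def)
    have "k(Suc n := l) \<in> {1..Suc n} \<rightarrow>\<^sub>E {..<M}"
    proof (rule PiE_I)
      fix i assume "i \<in> {1..Suc n}"
      thus "(k(Suc n := l)) i \<in> {..<M}" using k[of i] a by auto
    next
      fix i assume "i \<notin> {1..Suc n}"
      thus "(k(Suc n := l)) i = undefined"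
        using a by (auto simp: strict_seqs_def PiE_def extensional_def)
    qed
    moreover have "strict_mono_on {1..Suc n} (k(Suc n := l))"
      using k mono by (auto simp: strict_mono_on_def)
    ultimately show ?case using a by (simp add: strict_seqs_def)
  next
    case (3 k)
    show ?case by simp
  next
    case (4 k)
    hence k: "k \<in> {1..Suc n} \<rightarrow>\<^sub>E {..<M}" and mono: "strict_mono_on {1..Suc n} k"
      by (auto simp: strict_seqs_def)
    have "k(Suc n := undefined) \<in> {1..n} \<rightarrow>\<^sub>E {..<k (Suc n)}"
    proof (rule PiE_I)
      fix i assume "i \<in> {1..n}"
      thus "(k(Suc n := undefined)) i \<in> {..<k (Suc n)}"
        using mono by (auto simp: strict_mono_on_def)
    next
      fix i assume "i \<notin> {1..n}"
      thus "(k(Suc n := undefined)) i = undefined"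
        using k by (auto simp: PiE_def extensional_def)
    qed
    moreover have "strict_mono_on {1..n} (k(Suc n := undefined))"
      using mono by (auto simp: strict_mono_on_def)
    moreover have "k (Suc n) < M" using k by auto
    ultimately show ?case by (simp add: strict_seqs_def)
  next
    case (5 a)
    then obtain l k where a: "a = (l, k)" by (cases a)
    have "(\<Prod>i=1..n. z i ^ (k(Suc n := l)) i) = (\<Prod>i=1..n. z i ^ k i)"
      by (intro prod.cong) auto
    thus ?case using a by (simp add: mult.commute)
  qed
  finally show ?thesis by simp
qed

lemma prod_pairs_Suc:
  fixes p :: "nat \<Rightarrow> nat \<Rightarrow> 'a::comm_monoid_mult"
  shows "(\<Prod>(i, j)\<in>pairs {1..Suc n}. p i j) = (\<Prod>i=1..n. p i (Suc n)) * (\<Prod>(i, j)\<in>pairs {1..n}. p i j)"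
proof -
  have "pairs {1..Suc n} = (\<lambda>i. (i, Suc n)) ` {1..n} \<union> pairs {1..n}"
    by (auto simp: pairs_def)
  moreover have "(\<lambda>i. (i, Suc n)) ` {1..n} \<inter> pairs {1..n} = {}"
    by (auto simp: pairs_def)
  ultimately show ?thesis
    by (simp add: prod.union_disjoint prod.reindex inj_on_def)
qed

text \<open>The head \<sigma>(n+1) supplies the pairs (i, n+1) and the largest exponent. The product
  over the earlier pairs does not depend on the bound and leaves the sum.\<close>

lemma ordering_weight_rev_map:
  assumes "inj_on \<sigma> {1..n}"
  shows "ordering_weight Q c X (rev (map \<sigma> [1..<Suc n])) M
    = (\<Prod>(i, j)\<in>pairs {1..n}. mixed_factor Q c (X (\<sigma> i)) (X (\<sigma> j)) / (X (\<sigma> j) - X (\<sigma> i)))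
      * (\<Sum>k\<in>strict_seqs n M. \<Prod>i=1..n. weight Q (X (\<sigma> i)) ^ k i)"
  using assms
proof (induction n arbitrary: M)
  case 0
  \<comment> \<open>There is exactly one empty sequence, for every bound including 0, so the sum is
    1.\<close>
  have "strict_seqs 0 M = {\<lambda>_. undefined}"
    by (auto simp: strict_seqs_def strict_mono_on_def)
  thus ?case by (simp add: pairs_def)
next
  case (Suc n)
  have inj: "inj_on \<sigma> {1..n}" using Suc.prems by (rule inj_on_subset) auto
  define P where "P = (\<Prod>(i, j)\<in>pairs {1..n}. mixed_factor Q c (X (\<sigma> i)) (X (\<sigma> j)) / (X (\<sigma> j) - X (\<sigma> i)))"
  have set: "set (rev (map \<sigma> [1..<Suc n])) = \<sigma> ` {1..n}" by auto
  have list: "rev (map \<sigma> [1..<Suc (Suc n)]) = \<sigma> (Suc n) # rev (map \<sigma> [1..<Suc n])" by simp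
  have "ordering_weight Q c X (rev (map \<sigma> [1..<Suc (Suc n)])) M
      = (\<Prod>i=1..n. mixed_factor Q c (X (\<sigma> i)) (X (\<sigma> (Suc n))) / (X (\<sigma> (Suc n)) - X (\<sigma> i)))
        * (\<Sum>l<M. weight Q (X (\<sigma> (Suc n))) ^ l * (P * (\<Sum>k\<in>strict_seqs n l. \<Prod>i=1..n. weight Q (X (\<sigma> i)) ^ k i)))"
    unfolding list ordering_weight.simps set Suc.IH[OF inj] P_def prod.reindex[OF inj] o_def ..
  also have "\<dots> = ((\<Prod>i=1..n. mixed_factor Q c (X (\<sigma> i)) (X (\<sigma> (Suc n))) / (X (\<sigma> (Suc n)) - X (\<sigma> i))) * P)
        * (\<Sum>l<M. weight Q (X (\<sigma> (Suc n))) ^ l * (\<Sum>k\<in>strict_seqs n l. \<Prod>i=1..n. weight Q (X (\<sigma> i)) ^ k i))"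
    by (simp add: sum_distrib_left mult_ac)
  finally show ?case
    unfolding P_def prod_pairs_Suc sum_strict_seqs_Suc .
qed

text \<open>The unused entry \<open>X 0\<close> extends the Vandermonde matrix by a row that the permutation fixes.\<close>

lemma prod_pairs_diff_permutes:
  fixes X :: "nat \<Rightarrow> 'a::field"
  assumes \<sigma>: "\<sigma> permutes {1..n}" and X0: "\<And>i. i \<in> {1..n} \<Longrightarrow> X i \<noteq> X 0"
  shows "(\<Prod>(i, j)\<in>pairs {1..n}. X (\<sigma> j) - X (\<sigma> i))
    = of_int (sign \<sigma>) * (\<Prod>(i, j)\<in>pairs {1..n}. X j - X i)"
proof -
  have split: "(\<Prod>(i, j)\<in>pairs {..<Suc n}. f j - f i)
      = (\<Prod>j\<in>{1..n}. f j - f 0) * (\<Prod>(i, j)\<in>pairs {1..n}. f j - f i)" for f :: "nat \<Rightarrow> 'a"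
  proof -
    have "pairs {..<Suc n} = (\<lambda>j. (0, j)) ` {1..n} \<union> pairs {1..n}"
      by (auto simp: pairs_def)
    moreover have "(\<lambda>j. (0, j)) ` {1..n} \<inter> pairs {1..n} = {}"
      by (auto simp: pairs_def)
    ultimately show ?thesis by (simp add: prod.union_disjoint prod.reindex inj_on_def)
  qed
  have p: "\<sigma> permutes {0..<Suc n}" using \<sigma> by (rule permutes_subset) auto
  have \<sigma>0: "\<sigma> 0 = 0" using \<sigma> by (rule permutes_not_in) auto
  have "(\<Prod>(i, j)\<in>pairs {..<Suc n}. X (\<sigma> j) - X (\<sigma> i))
      = det (mat (Suc n) (Suc n) (\<lambda>(i, j). X (\<sigma> i) ^ j))"
    by (rule det_vandermonde[symmetric])
  also have "\<dots> = det (mat (Suc n) (Suc n) (\<lambda>(i, j). mat (Suc n) (Suc n) (\<lambda>(i, j). X i ^ j) $$ (\<sigma> i, j)))"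
  proof (intro arg_cong[of _ _ det] cong_mat refl)
    fix i j assume "i < Suc n" "j < Suc n"
    moreover from this have "\<sigma> i < Suc n" using permutes_in_image[OF p, of i] by simp
    ultimately show "(case (i, j) of (i, j) \<Rightarrow> X (\<sigma> i) ^ j)
        = (case (i, j) of (i, j) \<Rightarrow> mat (Suc n) (Suc n) (\<lambda>(i, j). X i ^ j) $$ (\<sigma> i, j))"
      by simp
  qed
  also have "\<dots> = of_int (sign \<sigma>) * (\<Prod>(i, j)\<in>pairs {..<Suc n}. X j - X i)"
    by (subst det_permute_rows[OF _ p]) (auto simp: det_vandermonde)
  finally have "(\<Prod>j\<in>{1..n}. X (\<sigma> j) - X 0) * (\<Prod>(i, j)\<in>pairs {1..n}. X (\<sigma> j) - X (\<sigma> i))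
      = (\<Prod>j\<in>{1..n}. X j - X 0) * (of_int (sign \<sigma>) * (\<Prod>(i, j)\<in>pairs {1..n}. X j - X i))"
    unfolding split[of X] split[of "\<lambda>i. X (\<sigma> i)"] \<sigma>0 by (simp only: mult_ac)
  also have "(\<Prod>j\<in>{1..n}. X (\<sigma> j) - X 0) = (\<Prod>j\<in>{1..n}. X j - X 0)"
    using prod.permute[OF \<sigma>, of "\<lambda>j. X j - X 0"] by (simp add: o_def)
  finally show ?thesis using X0 by simp
qed

text \<open>The sign is absorbed by the Vandermonde product, since sgn \<sigma> divided by it is the
  reciprocal of the permuted product. Each term is then the weight of one ordering, with exclusive
  bound m + 1.\<close>

lemma ASym_eq_ordering_sum:
  fixes X :: "nat \<Rightarrow> 'a::field"
  assumes X0: "\<And>i. i \<in> {1..n} \<Longrightarrow> X i \<noteq> X 0"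
  shows "1 / (\<Prod>(i, j)\<in>pairs {1..n}. X j - X i) *
      ASym n (\<lambda>x. (\<Prod>(i, j)\<in>pairs {1..n}. mixed_factor Q c (x i) (x j)) *
        (\<Sum>k\<in>incr_seqs n m. \<Prod>i=1..n. weight Q (x i) ^ k i)) X
    = ordering_sum Q c X {1..n} (Suc m)"
proof -
  have "1 / (\<Prod>(i, j)\<in>pairs {1..n}. X j - X i) * (of_int (sign \<sigma>) *
        ((\<Prod>(i, j)\<in>pairs {1..n}. mixed_factor Q c (X (\<sigma> i)) (X (\<sigma> j))) *
        (\<Sum>k\<in>incr_seqs n m. \<Prod>i=1..n. weight Q (X (\<sigma> i)) ^ k i)))
      = ordering_weight Q c X (rev (map \<sigma> [1..<Suc n])) (Suc m)" if \<sigma>: "\<sigma> permutes {1..n}" for \<sigma>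
  proof -
    have "of_int (sign \<sigma>) / (\<Prod>(i, j)\<in>pairs {1..n}. X j - X i)
        = 1 / (\<Prod>(i, j)\<in>pairs {1..n}. X (\<sigma> j) - X (\<sigma> i))"
      using prod_pairs_diff_permutes[of \<sigma> n X, OF \<sigma> X0] by (auto simp: sign_def)
    moreover have "1 / v * (s * (a * b)) = a / w * b" if "s / v = 1 / w" for a b s v w :: 'a
      using arg_cong[OF that, of "\<lambda>t. t * (a * b)"] by simp
    ultimately show ?thesis
      unfolding ordering_weight_rev_map[OF permutes_inj_on[OF \<sigma>]] incr_seqs_eq case_prod_unfold prod_dividef
      by blast
  qed
  thus ?thesis
    unfolding ASym_def ordering_sum_def sum_permutes_eq_sum_permutations_of_set[symmetric]
    by (simp only: sum_distrib_left) (intro sum.cong refl, simp)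
qed

section \<open>Nondegeneracy of the indeterminates\<close>

lemma indet_inject [simp]: "indet a = (indet b :: 'k::field ratfun) \<longleftrightarrow> a = b"
proof
  assume "indet a = (indet b :: 'k ratfun)"
  hence "Poly_Mapping.single (Poly_Mapping.single a (1::nat)) (1::'k)
      = Poly_Mapping.single (Poly_Mapping.single b 1) 1"
    by (simp add: indet_def eq_fract)
  hence "Poly_Mapping.single a (1::nat) = Poly_Mapping.single b 1"
    by (metis lookup_single_eq lookup_single_not_eq zero_neq_one)
  thus "a = b"
    by (metis lookup_single_eq lookup_single_not_eq zero_neq_one)
qed simp

text \<open>Reduces the nonvanishing conditions of \<open>generic\<close> to exhibiting a single
  monomial with nonzero coefficient.\<close>

lemma Fract_1_nonzero:
  assumes "Poly_Mapping.lookup p \<mu> \<noteq> 0"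
  shows "Fract p 1 \<noteq> (0 :: 'k::field ratfun)"
  using assms by (auto simp: Zero_fract_def eq_fract)

lemma single_add_single_neq_single:
  "Poly_Mapping.single a (Suc 0) + Poly_Mapping.single b (Suc 0) \<noteq> Poly_Mapping.single d (Suc 0)"
proof
  assume eq: "Poly_Mapping.single a (Suc 0) + Poly_Mapping.single b (Suc 0) = Poly_Mapping.single d (Suc 0)"
  have "Poly_Mapping.lookup (Poly_Mapping.single a (Suc 0) + Poly_Mapping.single b (Suc 0)) a
      = Poly_Mapping.lookup (Poly_Mapping.single d (Suc 0)) a" by (simp only: eq)
  moreover have "Poly_Mapping.lookup (Poly_Mapping.single a (Suc 0) + Poly_Mapping.single b (Suc 0)) b
      = Poly_Mapping.lookup (Poly_Mapping.single d (Suc 0)) b" by (simp only: eq)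
  ultimately show False by (auto simp: lookup_add lookup_single when_def split: if_splits)
qed

lemma single_add_single_neq:
  assumes "d \<noteq> a" "d \<noteq> b"
  shows "Poly_Mapping.single a (Suc 0) + Poly_Mapping.single b (Suc 0)
    \<noteq> Poly_Mapping.single d (Suc 0) + Poly_Mapping.single e (Suc 0)"
proof
  assume eq: "Poly_Mapping.single a (Suc 0) + Poly_Mapping.single b (Suc 0)
    = Poly_Mapping.single d (Suc 0) + Poly_Mapping.single e (Suc 0)"
  have "Poly_Mapping.lookup (Poly_Mapping.single a (Suc 0) + Poly_Mapping.single b (Suc 0)) d
      = Poly_Mapping.lookup (Poly_Mapping.single d (Suc 0) + Poly_Mapping.single e (Suc 0)) d" by (simp only: eq)
  thus False using assms by (simp add: lookup_add lookup_single when_def split: if_splits)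
qed

lemma single_neq_single:
  "a \<noteq> b \<Longrightarrow> Poly_Mapping.single a (Suc 0) \<noteq> Poly_Mapping.single b (Suc 0)"
  by (metis lookup_single_eq lookup_single_not_eq nat.distinct(1))

lemma single_Suc_0_neq_0: "Poly_Mapping.single a (Suc 0) \<noteq> 0"
  by (metis lookup_single_eq lookup_zero nat.distinct(1))

text \<open>Apart from X_i itself and \<open>inner_factor\<close>, every expression contains the
  monomial Q with coefficient 1, whatever the characteristic.\<close>

lemma generic_indet:
  assumes "0 \<notin> I"
  shows "generic (indet_Q :: 'k::field ratfun) (indet_Q + indet_r) indet_X I"
proof -
  note defs = indet_Q_def indet_r_def indet_X_def indet_def
  note nz = single_add_single_neq_single single_neq_single single_add_single_neq single_Suc_0_neq_0
  let ?s = "\<lambda>i. Poly_Mapping.single i (Suc 0) :: nat \<Rightarrow>\<^sub>0 nat"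
  note lk = lookup_add lookup_minus lookup_single mult_single when_def ring_distribs
  show ?thesis
  proof
    show "indet_Q \<noteq> (0 :: 'k ratfun)"
      unfolding defs by (rule Fract_1_nonzero[of _ "?s 0"]) simp
    show "inj_on (indet_X :: nat \<Rightarrow> 'k ratfun) I"
      by (auto simp: inj_on_def indet_X_def)
    fix i assume i: "i \<in> I"
    \<comment> \<open>X_i is the variable numbered i + 1, so index 0 would collide with r.\<close>
    hence i0: "i > 0" using assms by (cases i) auto
    show "indet_X i \<noteq> (0 :: 'k ratfun)"
      unfolding defs by (rule Fract_1_nonzero[of _ "?s (Suc i)"]) simp
    show "indet_Q + indet_X i \<noteq> (0 :: 'k ratfun)"
      unfolding defs
      by (simp, rule Fract_1_nonzero[of _ "?s 0"]) (use i0 in \<open>simp add: lk nz\<close>)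
    show "indet_Q + indet_r + indet_X i \<noteq> (0 :: 'k ratfun)"
      unfolding defs
      by (simp, rule Fract_1_nonzero[of _ "?s 0"]) (use i0 in \<open>simp add: lk nz\<close>)
    show "indet_Q + (indet_Q + indet_r) * indet_X i \<noteq> (0 :: 'k ratfun)"
      unfolding defs
      by (simp, rule Fract_1_nonzero[of _ "?s 0"]) (use i0 in \<open>simp add: lk nz\<close>)
    fix j assume j: "j \<in> I"
    hence j0: "j > 0" using assms by (cases j) auto
    show "indet_Q - indet_X i * indet_X j \<noteq> (0 :: 'k ratfun)"
      unfolding defs
      by (simp, rule Fract_1_nonzero[of _ "?s 0"]) (use i0 j0 in \<open>simp add: lk nz\<close>)
    show "mixed_factor indet_Q (indet_Q + indet_r) (indet_X i) (indet_X j) \<noteq> (0 :: 'k ratfun)"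
      unfolding defs mixed_factor_def
      by (simp, rule Fract_1_nonzero[of _ "?s 0"]) (use i0 j0 in \<open>simp add: lk nz\<close>)
    \<comment> \<open>All monomials here have degree two. The witness is Q r, from c Q = Q^2 + Q
      r.\<close>
    show "inner_factor indet_Q (indet_Q + indet_r) (indet_X i) (indet_X j) \<noteq> (0 :: 'k ratfun)"
      unfolding defs inner_factor_def
      by (simp, rule Fract_1_nonzero[of _ "?s (Suc 0) + ?s 0"]) (use i0 j0 in \<open>simp add: lk nz\<close>)
  qed
qed

section \<open>The determinant entries and the final identity\<close>

text \<open>The lone factor 1 + x in the second term of \<open>a_entry\<close> is (Q + x)/x times
  \<open>weight Q x\<close>. Both terms thus share the row factor (Q + x)/x, and the exponent of the
  weight becomes m + 1.\<close>

lemma a_entry_eq: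
  fixes Q r x :: "'a::field"
  assumes "x \<noteq> 0" "Q + x \<noteq> 0"
  shows "a_entry (j + 1) m n Q r x = (Q + x) / x *
    (basis_fun n Q (Q + r) j x - x ^ (2 * n) / Q ^ n * weight Q x ^ Suc m * basis_fun n Q (Q + r) j (Q / x))"
proof -
  have 1: "1 + Q * inverse x = (Q + x) / x" using assms by (simp add: field_simps)
  have 2: "weight Q x ^ Suc m = ((1 + x) * x / (Q + x)) ^ m * (x * (1 + x) / (Q + x))"
    by (simp add: weight_def mult.commute)
  have 3: "Q + r * x + Q * x = Q + (Q + r) * x" by (simp add: algebra_simps)
  have 4: "Q + r * Q * inverse x + Q\<^sup>2 * inverse x = Q + (Q + r) * (Q / x)"
    by (simp add: power2_eq_square divide_inverse algebra_simps)
  have 5: "n - (j + 1) = n - 1 - j" by simp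
  have 6: "1 + Q / x = (Q + x) / x" using assms by (simp add: field_simps)
  have 7: "(Q + x) / x * (x * (1 + x) / (Q + x)) = 1 + x" using assms by simp
  have b1: "basis_fun n Q (Q + r) j x = x ^ (j + 1) * (1 + x) ^ j * (Q + (Q + r) * x) ^ (n - 1 - j)"
    by (simp add: basis_fun_def power_mult_distrib)
  have b2: "basis_fun n Q (Q + r) j (Q / x)
      = (Q * inverse x) ^ (j + 1) * ((Q + x) / x) ^ j * (Q + (Q + r) * (Q / x)) ^ (n - 1 - j)"
    unfolding basis_fun_def 6 by (simp add: power_mult_distrib divide_inverse)
  have "(Q + x) / x * (x ^ (2 * n) / Q ^ n * (((1 + x) * x / (Q + x)) ^ m * (x * (1 + x) / (Q + x)))
      * basis_fun n Q (Q + r) j (Q / x))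
      = x ^ (2 * n) / Q ^ n * ((1 + x) * x / (Q + x)) ^ m
        * ((Q + x) / x * (x * (1 + x) / (Q + x))) * basis_fun n Q (Q + r) j (Q / x)"
    by (simp only: mult_ac)
  also have "\<dots> = x ^ (2 * n) * inverse (Q ^ n) * ((1 + x) * x / (Q + x)) ^ m * (1 + x)
      * basis_fun n Q (Q + r) j (Q / x)"
    unfolding 7 by (simp only: divide_inverse)
  finally show ?thesis
    unfolding a_entry_def 1 2 3 4 5 right_diff_distrib b1 b2 add_diff_cancel_right'
    by (simp only: mult_ac)
qed

theorem theorem1p1:
  fixes n m :: nat
    and Q r :: "'k::field ratfun"
    and X :: "nat \<Rightarrow> 'k ratfun"
  assumes "n \<ge> 1"
    and "Q = indet_Q" and "r = indet_r" and "X = indet_X"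
  shows
    "1 / (\<Prod>(i, j)\<in>{(i, j). 1 \<le> i \<and> i < j \<and> j \<le> n}. X j - X i) *
       ASym n (\<lambda>x.
         (\<Prod>(i, j)\<in>{(i, j). 1 \<le> i \<and> i < j \<and> j \<le> n}.
            Q + (Q + r) * x i + x j + x i * x j) *
         (\<Sum>k\<in>incr_seqs n m. \<Prod>i=1..n. (x i * (1 + x i) / (Q + x i)) ^ k i)) X
     = det (mat n n (\<lambda>(i, j). a_entry (j + 1) m n Q r (X (i + 1)))) /
       ((\<Prod>(i, j)\<in>{(i, j). 1 \<le> i \<and> i \<le> j \<and> j \<le> n}. Q - X i * X j) *
        (\<Prod>(i, j)\<in>{(i, j). 1 \<le> i \<and> i < j \<and> j \<le> n}. X j - X i))"
proof -
  have pairs: "{(i, j). 1 \<le> i \<and> i < j \<and> j \<le> n} = pairs {1..n}"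
    by (auto simp: pairs_def)
  have wpairs: "{(i, j). 1 \<le> i \<and> i \<le> j \<and> j \<le> n} = (\<lambda>i. (i, i)) ` {1..n} \<union> pairs {1..n}"
    by (auto simp: pairs_def)
  have diag: "(\<Prod>(i, j)\<in>(\<lambda>i. (i, i)) ` {1..n} \<union> pairs {1..n}. Q - X i * X j)
      = (\<Prod>i\<in>{1..n}. Q - X i * X i) * (\<Prod>(i, j)\<in>pairs {1..n}. Q - X i * X j)"
  proof -
    have "(\<lambda>i. (i, i)) ` {1..n} \<inter> pairs {1..n} = {}" by (auto simp: pairs_def)
    thus ?thesis by (simp add: prod.union_disjoint prod.reindex inj_on_def)
  qed
  \<comment> \<open>Matrix rows are numbered from 0 and the indeterminates from 1; the shift by
    \<open>Suc\<close> is increasing, as \<open>subset_sum_reindex\<close> requires.\<close>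
  have im: "{1..n} = Suc ` {..<n}" by (auto simp: image_Suc_lessThan)
  have pim: "pairs {1..n} = map_prod Suc Suc ` pairs {..<n}"
    unfolding im by (auto simp: pairs_def image_iff)
  have pre: "(\<Prod>(i, j)\<in>pairs {1..n}. f i j) = (\<Prod>(i, j)\<in>pairs {..<n}. f (Suc i) (Suc j))"
    for f :: "nat \<Rightarrow> nat \<Rightarrow> 'k ratfun"
    unfolding pim by (subst prod.reindex) (auto simp: inj_on_def case_prod_unfold)
  have gen: "generic Q (Q + r) X {1..n}"
    unfolding assms(2-4) by (rule generic_indet) simp
  have gen': "generic Q (Q + r) (X \<circ> Suc) {..<n}"
    using gen unfolding im by (rule generic_reindex) simp
  interpret g: generic Q "Q + r" "X \<circ> Suc" "{..<n}" by fact
  \<comment> \<open>\<open>X 0\<close> is the indeterminate r, which serves as the auxiliary node in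
    \<open>prod_pairs_diff_permutes\<close>.\<close>
  have X0: "X i \<noteq> X 0" if "i \<in> {1..n}" for i
    using that by (simp add: assms indet_X_def)
  have "1 / (\<Prod>(i, j)\<in>pairs {1..n}. X j - X i) *
       ASym n (\<lambda>x. (\<Prod>(i, j)\<in>pairs {1..n}. Q + (Q + r) * x i + x j + x i * x j) *
         (\<Sum>k\<in>incr_seqs n m. \<Prod>i=1..n. (x i * (1 + x i) / (Q + x i)) ^ k i)) X
      = subset_sum Q (Q + r) X {1..n} (Suc m)"
    using ASym_eq_ordering_sum[of n X Q "Q + r" m, OF X0] ordering_sum_eq_subset_sum[OF gen]
    unfolding mixed_factor_def weight_def by simp
  also have "\<dots> = subset_sum Q (Q + r) (X \<circ> Suc) {..<n} (Suc m)"
    unfolding im by (rule subset_sum_reindex) (simp add: strict_mono_on_def)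
  \<comment> \<open>The product of the (Q + X_i)/X_i moves back into the rows, where
    \<open>a_entry_eq\<close> expects it.\<close>
  also have "\<dots> = det (mat n n (\<lambda>(i, j). (Q + X (Suc i)) / X (Suc i) *
        (basis_fun n Q (Q + r) j (X (Suc i)) - X (Suc i) ^ (2 * n) / Q ^ n * weight Q (X (Suc i)) ^ Suc m
          * basis_fun n Q (Q + r) j (Q / X (Suc i)))))
      / ((\<Prod>i<n. Q - X (Suc i) * X (Suc i)) * (\<Prod>(i, j)\<in>pairs {..<n}. Q - X (Suc i) * X (Suc j))
        * (\<Prod>(i, j)\<in>pairs {..<n}. X (Suc j) - X (Suc i)))"
    unfolding subset_sum_eq_det[OF gen'] by (subst det_mat_scale_rows) (simp only: o_def)
  also have "mat n n (\<lambda>(i, j). (Q + X (Suc i)) / X (Suc i) *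
        (basis_fun n Q (Q + r) j (X (Suc i)) - X (Suc i) ^ (2 * n) / Q ^ n * weight Q (X (Suc i)) ^ Suc m
          * basis_fun n Q (Q + r) j (Q / X (Suc i))))
      = mat n n (\<lambda>(i, j). a_entry (j + 1) m n Q r (X (i + 1)))"
  proof (intro cong_mat refl, goal_cases)
    case (1 i j)
    hence "X (Suc i) \<noteq> 0" "Q + X (Suc i) \<noteq> 0" using g.X_nz[of i] g.QX_nz[of i] by auto
    thus ?case unfolding split Suc_eq_plus1[symmetric, of i] by (rule a_entry_eq[symmetric])
  qed
  also have "(\<Prod>i<n. Q - X (Suc i) * X (Suc i)) = (\<Prod>i\<in>{1..n}. Q - X i * X i)"
    unfolding im by (simp add: prod.reindex)
  finally show ?thesis
    unfolding pairs wpairs diag pre by (simp only: mult.assoc)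
qed

end
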